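(* Let $(Q,i,g)$ be a Kähler manifold and equip $T^*Q$ with its canonical CRPS structure. Define $H^0:T^*Q\to\mathbb R$ by $H^0(q,p)=\frac12|p|^2$, where the norm is taken with respect to the dual metric of $g$. If $Z:\mathbb T^2\to T^*Q$ is a (smooth) critical point of $\mathcal A_{H^0}$ and $\pi:T^*Q\to Q$ is the projection, then $q=\pi\circ Z:\mathbb T^2\to Q$ is a harmonic map.
   Context: $\mathbb T^2$ is the flat two-torus with coordinates $(x,y)$ and volume form $d\mathcal V=dx\wedge dy$. Canonical CRPS structure on $T^*Q$: $I$ is the complex structure on $T^*Q$ for which, whenever $q^j=q_1^j+iq_2^j$ are holomorphic coordinates on $Q$ and $p_j^1,p_j^2$ are the dual fibre coordinates (so the Liouville form is $\lambda=\sum_jp_j^1dq_1^j+p_j^2dq_2^j$, i.e. $\lambda_{(q,p)}=p\circ d\pi$), the functions $q^j$ and $p_j=p_j^1-ip_j^2$ are holomorphic. The CRPS form is the pair $\omega_1=d\lambda$, $\omega_2=-d(\lambda\circ I)$ of symplectic forms, which satisfies $\omega_2=-\omega_1(\cdot,I\cdot)$. Set $\theta_1=\lambda$, $\theta_2=-\lambda\circ I$. For a Hamiltonian $H$ the action of a smooth map $Z:\mathbb T^2\to T^*Q$ is $$\mathcal A_H(Z)=\int_{\mathbb T^2}\big(\theta_1(\partial_xZ)+\theta_2(\partial_yZ)-H(Z)\big)\,d\mathcal V.$$ Its critical points are exactly the solutions of $\omega_1(\cdot,\partial_xZ)+\omega_2(\cdot,\partial_yZ)=dH(Z)$. *)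

theory Defs
  imports "HOL-Analysis.Analysis"
begin

section \<open>Smooth and holomorphic maps on open subsets of Euclidean spaces\<close>

primrec cont_diff_on :: "nat \<Rightarrow> 'a::euclidean_space set \<Rightarrow> ('a \<Rightarrow> 'b::real_normed_vector) \<Rightarrow> bool" where
  "cont_diff_on 0 S f \<longleftrightarrow> continuous_on S f"
| "cont_diff_on (Suc k) S f \<longleftrightarrow>
     (\<forall>x\<in>S. f differentiable (at x)) \<and>
     (\<forall>h. cont_diff_on k S (\<lambda>x. frechet_derivative f (at x) h))"

definition smooth_on :: "'a::euclidean_space set \<Rightarrow> ('a \<Rightarrow> 'b::real_normed_vector) \<Rightarrow> bool" where
  "smooth_on S f \<longleftrightarrow> (\<forall>k. cont_diff_on k S f)"

text \<open>Holomorphy in several variables: at each point the real Frechet derivative exists and is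
  complex linear.\<close>

definition vec_holomorphic_on :: "(complex^'n \<Rightarrow> complex^'k) \<Rightarrow> (complex^'n) set \<Rightarrow> bool" where
  "vec_holomorphic_on f S \<longleftrightarrow>
     (\<forall>x\<in>S. \<exists>D. (f has_derivative D) (at x) \<and> (\<forall>h. D (\<i> *s h) = \<i> *s D h))"

section \<open>Complex manifolds\<close>

text \<open>A chart is a pair of its domain and its coordinate map; the values of the coordinate map
  outside the domain are irrelevant.  A manifold is given by its atlas: its underlying set is the
  union of the chart domains, and its topology is the one generated by the charts.\<close>

type_synonym ('m, 'n) chart = "'m set \<times> ('m \<Rightarrow> (complex, 'n) vec)"

abbreviation cdom :: "('m, 'n::finite) chart \<Rightarrow> 'm set" where "cdom c \<equiv> fst c"
abbreviation cmap :: "('m, 'n::finite) chart \<Rightarrow> 'm \<Rightarrow> complex^'n" where "cmap c \<equiv> snd c"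
abbreviation cinv :: "('m, 'n::finite) chart \<Rightarrow> complex^'n \<Rightarrow> 'm" where
  "cinv c \<equiv> inv_into (fst c) (snd c)"

definition carrier_of :: "('m, 'n::finite) chart set \<Rightarrow> 'm set" where
  "carrier_of A = (\<Union>c\<in>A. cdom c)"

definition atlas_topology :: "('m, 'n::finite) chart set \<Rightarrow> 'm topology" where
  "atlas_topology A = topology_generated_by {{m \<in> cdom c. cmap c m \<in> V} | c V. c \<in> A \<and> open V}"

definition complex_manifold :: "('m, 'n::finite) chart set \<Rightarrow> bool" where
  "complex_manifold A \<longleftrightarrow>
     (\<forall>c\<in>A. inj_on (cmap c) (cdom c) \<and> open (cmap c ` cdom c)) \<and>
     (\<forall>c\<in>A. \<forall>d\<in>A. open (cmap c ` (cdom c \<inter> cdom d)) \<and>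
        vec_holomorphic_on (cmap d \<circ> cinv c) (cmap c ` (cdom c \<inter> cdom d))) \<and>
     Hausdorff_space (atlas_topology A) \<and> second_countable (atlas_topology A)"

section \<open>Tangent and cotangent vectors\<close>

text \<open>A tangent vector at a point is a family of coordinate vectors, one for each chart around the
  point, transforming by the derivatives of the coordinate changes.  For uniqueness the
  family is zero at all other charts.\<close>

type_synonym ('m, 'n) tvec = "('m, 'n) chart \<Rightarrow> (complex, 'n) vec"

definition tangent_space :: "('m, 'n::finite) chart set \<Rightarrow> 'm \<Rightarrow> ('m, 'n) tvec set" where
  "tangent_space A m = {v.
     (\<forall>c\<in>A. \<forall>d\<in>A. m \<in> cdom c \<inter> cdom d \<longrightarrow>
        v d = frechet_derivative (cmap d \<circ> cinv c) (at (cmap c m)) (v c)) \<and>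
     (\<forall>c. \<not> (c \<in> A \<and> m \<in> cdom c) \<longrightarrow> v c = 0)}"

text \<open>The tangent vector at \<open>m\<close> whose coordinate vector in the chart \<open>c\<close> is \<open>h\<close>.\<close>

definition coord_vec ::
  "('m, 'n::finite) chart set \<Rightarrow> ('m, 'n) chart \<Rightarrow> 'm \<Rightarrow> complex^'n \<Rightarrow> ('m, 'n) tvec" where
  "coord_vec A c m h = (\<lambda>d. if d \<in> A \<and> m \<in> cdom d
     then frechet_derivative (cmap d \<circ> cinv c) (at (cmap c m)) h else 0)"

text \<open>The complex structure of a complex manifold, on a single tangent vector.\<close>

definition cstruct :: "('m, 'n::finite) tvec \<Rightarrow> ('m, 'n) tvec" where
  "cstruct v = (\<lambda>c. \<i> *s v c)"

definition linear_at ::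
  "('m, 'n::finite) chart set \<Rightarrow> 'm \<Rightarrow> (('m, 'n) tvec \<Rightarrow> real) \<Rightarrow> bool" where
  "linear_at A m f \<longleftrightarrow> (\<forall>u\<in>tangent_space A m. \<forall>v\<in>tangent_space A m. \<forall>a b.
     f (\<lambda>c. a *\<^sub>R u c + b *\<^sub>R v c) = a * f u + b * f v)"

definition cotangent_space ::
  "('m, 'n::finite) chart set \<Rightarrow> 'm \<Rightarrow> (('m, 'n) tvec \<Rightarrow> real) set" where
  "cotangent_space A m = {p. linear_at A m p \<and> (\<forall>v. v \<notin> tangent_space A m \<longrightarrow> p v = 0)}"

section \<open>Smooth maps and their derivatives\<close>

definition smooth_into ::
  "('m, 'n::finite) chart set \<Rightarrow> 'a::euclidean_space set \<Rightarrow> ('a \<Rightarrow> 'm) \<Rightarrow> bool" where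
  "smooth_into A S f \<longleftrightarrow> continuous_map (top_of_set S) (atlas_topology A) f \<and>
     (\<forall>c\<in>A. smooth_on {x \<in> S. f x \<in> cdom c} (cmap c \<circ> f))"

text \<open>Directional derivative of a map from a Euclidean space into a manifold.\<close>

definition dir_deriv ::
  "('m, 'n::finite) chart set \<Rightarrow> ('a::euclidean_space \<Rightarrow> 'm) \<Rightarrow> 'a \<Rightarrow> 'a \<Rightarrow> ('m, 'n) tvec" where
  "dir_deriv A f x h = (\<lambda>c. if c \<in> A \<and> f x \<in> cdom c
     then frechet_derivative (cmap c \<circ> f) (at x) h else 0)"

text \<open>Differential at \<open>m\<close> of a map between manifolds; it does not depend on the selected chart of
  the source.\<close>

definition differential ::
  "('m, 'n::finite) chart set \<Rightarrow> ('l, 'k::finite) chart set \<Rightarrow> ('m \<Rightarrow> 'l) \<Rightarrow> 'm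
     \<Rightarrow> ('m, 'n) tvec \<Rightarrow> ('l, 'k) tvec" where
  "differential A B F m v = (let c = (SOME c. c \<in> A \<and> m \<in> cdom c) in
     (\<lambda>d. if d \<in> B \<and> F m \<in> cdom d
        then frechet_derivative (cmap d \<circ> F \<circ> cinv c) (at (cmap c m)) (v c) else 0))"

section \<open>Kaehler manifolds\<close>

type_synonym ('m, 'n) bilinear_field = "'m \<Rightarrow> ('m, 'n) tvec \<Rightarrow> ('m, 'n) tvec \<Rightarrow> real"

definition local_coeff :: "('m, 'n::finite) chart set \<Rightarrow> ('m, 'n) bilinear_field
     \<Rightarrow> ('m, 'n) chart \<Rightarrow> complex^'n \<Rightarrow> complex^'n \<Rightarrow> complex^'n \<Rightarrow> real" where
  "local_coeff A b c h k = (\<lambda>x. b (cinv c x) (coord_vec A c (cinv c x) h) (coord_vec A c (cinv c x) k))"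

definition riemannian_metric ::
  "('m, 'n::finite) chart set \<Rightarrow> ('m, 'n) bilinear_field \<Rightarrow> bool" where
  "riemannian_metric A g \<longleftrightarrow>
     (\<forall>m\<in>carrier_of A.
        (\<forall>u\<in>tangent_space A m. linear_at A m (g m u)) \<and>
        (\<forall>u\<in>tangent_space A m. \<forall>v\<in>tangent_space A m. g m u v = g m v u) \<and>
        (\<forall>u\<in>tangent_space A m. u \<noteq> (\<lambda>c. 0) \<longrightarrow> g m u u > 0)) \<and>
     (\<forall>c\<in>A. \<forall>h k. smooth_on (cmap c ` cdom c) (local_coeff A g c h k))"

text \<open>Closedness of a 2-form: the coordinate expression of its exterior derivative, evaluated on
  constant vector fields \<open>h\<close>, \<open>k\<close>, \<open>l\<close>, vanishes.\<close>

definition closed_two_form ::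
  "('m, 'n::finite) chart set \<Rightarrow> ('m, 'n) bilinear_field \<Rightarrow> bool" where
  "closed_two_form A w \<longleftrightarrow> (\<forall>c\<in>A. \<forall>x\<in>cmap c ` cdom c. \<forall>h k l.
     frechet_derivative (local_coeff A w c k l) (at x) h
     - frechet_derivative (local_coeff A w c h l) (at x) k
     + frechet_derivative (local_coeff A w c h k) (at x) l = 0)"

definition kaehler_form :: "('m, 'n::finite) bilinear_field \<Rightarrow> ('m, 'n) bilinear_field" where
  "kaehler_form g = (\<lambda>m u v. g m (cstruct u) v)"

definition kaehler_manifold ::
  "('m, 'n::finite) chart set \<Rightarrow> ('m, 'n) bilinear_field \<Rightarrow> bool" where
  "kaehler_manifold A g \<longleftrightarrow> complex_manifold A \<and> riemannian_metric A g \<and>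
     (\<forall>m\<in>carrier_of A. \<forall>u\<in>tangent_space A m. \<forall>v\<in>tangent_space A m.
        g m (cstruct u) (cstruct v) = g m u v) \<and>
     closed_two_form A (kaehler_form g)"

section \<open>The cotangent bundle and its canonical structure\<close>

text \<open>Points of the cotangent bundle are pairs \<open>(q, p)\<close> with \<open>p\<close> in the cotangent space at \<open>q\<close>.  Its
  complex structure is determined by the atlas of the coordinates \<open>q\<^sup>j\<close> (index \<open>Inl j\<close>) and
  \<open>p\<^sub>j = p\<^sub>j\<^sup>1 - \<i> p\<^sub>j\<^sup>2\<close> (index \<open>Inr j\<close>), where \<open>p\<^sub>j\<^sup>1\<close> and \<open>p\<^sub>j\<^sup>2\<close> are the values of \<open>p\<close> on the coordinate
  vectors of the real and imaginary parts of \<open>q\<^sup>j\<close>.\<close>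

type_synonym ('m, 'n) cotangent = "'m \<times> (('m, 'n) tvec \<Rightarrow> real)"

definition cotangent_chart :: "('m, 'n::finite) chart set \<Rightarrow> ('m, 'n) chart
     \<Rightarrow> (('m, 'n) cotangent, 'n + 'n) chart" where
  "cotangent_chart A c =
     ({(q, p). q \<in> cdom c \<and> p \<in> cotangent_space A q},
      (\<lambda>(q, p). \<chi> k. case k of
          Inl j \<Rightarrow> cmap c q $ j
        | Inr j \<Rightarrow> complex_of_real (p (coord_vec A c q (axis j 1)))
                 - \<i> * complex_of_real (p (coord_vec A c q (axis j \<i>)))))"

definition cotangent_atlas ::
  "('m, 'n::finite) chart set \<Rightarrow> (('m, 'n) cotangent, 'n + 'n) chart set" where
  "cotangent_atlas A = cotangent_chart A ` A"

definition liouville :: "('m, 'n::finite) chart set \<Rightarrow> ('m, 'n) cotangent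
     \<Rightarrow> (('m, 'n) cotangent, 'n + 'n) tvec \<Rightarrow> real" where
  "liouville A z v = snd z (differential (cotangent_atlas A) A fst z v)"

text \<open>The primitives \<open>\<theta>\<^sub>1 = \<lambda>\<close> and \<open>\<theta>\<^sub>2 = - \<lambda> \<circ> I\<close> of the two forms of the CRPS structure.\<close>

definition theta1 :: "('m, 'n::finite) chart set \<Rightarrow> ('m, 'n) cotangent
     \<Rightarrow> (('m, 'n) cotangent, 'n + 'n) tvec \<Rightarrow> real" where
  "theta1 A z v = liouville A z v"

definition theta2 :: "('m, 'n::finite) chart set \<Rightarrow> ('m, 'n) cotangent
     \<Rightarrow> (('m, 'n) cotangent, 'n + 'n) tvec \<Rightarrow> real" where
  "theta2 A z v = - liouville A z (cstruct v)"

definition sharp :: "('m, 'n::finite) chart set \<Rightarrow> ('m, 'n) bilinear_field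
     \<Rightarrow> 'm \<Rightarrow> (('m, 'n) tvec \<Rightarrow> real) \<Rightarrow> ('m, 'n) tvec" where
  "sharp A g q p = (THE v. v \<in> tangent_space A q \<and> (\<forall>u\<in>tangent_space A q. g q v u = p u))"

definition dual_metric :: "('m, 'n::finite) chart set \<Rightarrow> ('m, 'n) bilinear_field \<Rightarrow> 'm
     \<Rightarrow> (('m, 'n) tvec \<Rightarrow> real) \<Rightarrow> (('m, 'n) tvec \<Rightarrow> real) \<Rightarrow> real" where
  "dual_metric A g q p p' = g q (sharp A g q p) (sharp A g q p')"

definition H0 :: "('m, 'n::finite) chart set \<Rightarrow> ('m, 'n) bilinear_field
     \<Rightarrow> ('m, 'n) cotangent \<Rightarrow> real" where
  "H0 A g = (\<lambda>(q, p). dual_metric A g q p p / 2)"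

section \<open>Functionals on maps from the torus\<close>

text \<open>The flat torus is \<open>\<real>\<^sup>2 / \<int>\<^sup>2\<close>; maps on it are doubly periodic maps on the plane, and integrals
  over it are integrals over the unit square.\<close>

definition doubly_periodic :: "(real \<times> real \<Rightarrow> 'm) \<Rightarrow> bool" where
  "doubly_periodic f \<longleftrightarrow> (\<forall>x y. f (x + 1, y) = f (x, y) \<and> f (x, y + 1) = f (x, y))"

definition smooth_torus_map ::
  "('m, 'n::finite) chart set \<Rightarrow> (real \<times> real \<Rightarrow> 'm) \<Rightarrow> bool" where
  "smooth_torus_map A f \<longleftrightarrow> doubly_periodic f \<and> smooth_into A UNIV f"

definition torus_integral :: "(real \<times> real \<Rightarrow> real) \<Rightarrow> real" where
  "torus_integral f = integral (cbox (0, 0) (1, 1)) f"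

definition deriv_x :: "('m, 'n::finite) chart set \<Rightarrow> (real \<times> real \<Rightarrow> 'm) \<Rightarrow> real \<times> real
     \<Rightarrow> ('m, 'n) tvec" where
  "deriv_x A f t = dir_deriv A f t (1, 0)"

definition deriv_y :: "('m, 'n::finite) chart set \<Rightarrow> (real \<times> real \<Rightarrow> 'm) \<Rightarrow> real \<times> real
     \<Rightarrow> ('m, 'n) tvec" where
  "deriv_y A f t = dir_deriv A f t (0, 1)"

definition smooth_variation :: "('m, 'n::finite) chart set \<Rightarrow> (real \<times> real \<Rightarrow> 'm) \<Rightarrow> real
     \<Rightarrow> (real \<Rightarrow> real \<times> real \<Rightarrow> 'm) \<Rightarrow> bool" where
  "smooth_variation A f \<epsilon> W \<longleftrightarrow> \<epsilon> > 0 \<and> W 0 = f \<and>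
     (\<forall>s\<in>{-\<epsilon><..<\<epsilon>}. doubly_periodic (W s)) \<and>
     smooth_into A ({-\<epsilon><..<\<epsilon>} \<times> UNIV) (\<lambda>(s, t). W s t)"

definition critical_point :: "('m, 'n::finite) chart set \<Rightarrow> ((real \<times> real \<Rightarrow> 'm) \<Rightarrow> real)
     \<Rightarrow> (real \<times> real \<Rightarrow> 'm) \<Rightarrow> bool" where
  "critical_point A \<Phi> f \<longleftrightarrow> smooth_torus_map A f \<and>
     (\<forall>\<epsilon> W. smooth_variation A f \<epsilon> W \<longrightarrow> ((\<lambda>s. \<Phi> (W s)) has_real_derivative 0) (at 0))"

definition action :: "('m, 'n::finite) chart set \<Rightarrow> (('m, 'n) cotangent \<Rightarrow> real)
     \<Rightarrow> (real \<times> real \<Rightarrow> ('m, 'n) cotangent) \<Rightarrow> real" where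
  "action A H Z = torus_integral (\<lambda>t.
     theta1 A (Z t) (deriv_x (cotangent_atlas A) Z t) +
     theta2 A (Z t) (deriv_y (cotangent_atlas A) Z t) - H (Z t))"

definition dirichlet_energy :: "('m, 'n::finite) chart set \<Rightarrow> ('m, 'n) bilinear_field
     \<Rightarrow> (real \<times> real \<Rightarrow> 'm) \<Rightarrow> real" where
  "dirichlet_energy A g q = torus_integral (\<lambda>t.
     (g (q t) (deriv_x A q t) (deriv_x A q t) + g (q t) (deriv_y A q t) (deriv_y A q t)) / 2)"

definition harmonic_map :: "('m, 'n::finite) chart set \<Rightarrow> ('m, 'n) bilinear_field
     \<Rightarrow> (real \<times> real \<Rightarrow> 'm) \<Rightarrow> bool" where
  "harmonic_map A g q \<longleftrightarrow> critical_point A (dirichlet_energy A g) q"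

end

theory Submission
  imports Defs
begin

text \<open>
  Write \<open>Z = (q, p)\<close> and \<open>v = \<partial>\<^sub>x q - \<i> \<partial>\<^sub>y q\<close>. The bundle projection is holomorphic, so
  \<open>\<theta>\<^sub>1 (\<partial>\<^sub>x Z) = p (\<partial>\<^sub>x q)\<close> and \<open>\<theta>\<^sub>2 (\<partial>\<^sub>y Z) = - p (\<i> \<partial>\<^sub>y q)\<close>, and the action is the integral of
  \<open>p (v) - \<bar>p\<bar>\<^sup>2 / 2\<close>. As a function of \<open>p\<close> this is a concave quadratic polynomial with maximum
  \<open>\<bar>v\<bar>\<^sup>2 / 2\<close> at the covector \<open>v\<^sup>\<flat>\<close> metrically dual to \<open>v\<close>. A critical point of the action therefore has
  \<open>p = v\<^sup>\<flat>\<close>; it is the lift of its projection \<open>q\<close> (lemma \<open>critical_point_is_lift\<close>).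

  On lifts the action is the integral of \<open>\<bar>v\<bar>\<^sup>2 / 2\<close>. Expanding the square gives the Dirichlet energy
  of \<open>q\<close> plus the integral of \<open>- g (\<partial>\<^sub>x q, \<i> \<partial>\<^sub>y q)\<close>, that is, of the pullback of the Kaehler form
  (lemma \<open>action_lift\<close>). The Kaehler form is closed, so by Stokes' theorem that second term does not
  change to first order when \<open>q\<close> is varied (lemma \<open>kaehler_area_stationary\<close>).

  A variation of \<open>q\<close> lifts to a variation of \<open>Z\<close> through lifts (lemma \<open>lift_variation\<close>). Along it the
  action has derivative zero, and hence so does the energy, so \<open>q\<close> is harmonic.

  The calculations on manifolds are carried out in one chart at a time. A tangent vector is determined
  by its coordinates in any chart, so the coordinate changes enter only through their complex linear
  first derivatives.
\<close>

section \<open>Calculus of smooth maps\<close>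

lemma cont_diff_on_subset: "cont_diff_on k T f \<Longrightarrow> S \<subseteq> T \<Longrightarrow> cont_diff_on k S f"
proof (induction k arbitrary: f)
  case 0 then show ?case by (auto intro: continuous_on_subset)
qed auto

lemma cont_diff_on_cong:
  assumes "open S" "\<And>x. x \<in> S \<Longrightarrow> f x = g x"
  shows "cont_diff_on k S f \<longleftrightarrow> cont_diff_on k S g"
  using assms(2)
proof (induction k arbitrary: f g)
  case 0 then show ?case by (auto intro: continuous_on_cong)
next
  case (Suc k)
  have D: "frechet_derivative f (at x) = frechet_derivative g (at x)" if "x \<in> S" for x
  proof -
    have "(f has_derivative D) (at x) \<longleftrightarrow> (g has_derivative D) (at x)" for D
      using that Suc.prems assms(1) by (metis has_derivative_transform_within_open)
    then show ?thesis by (simp add: frechet_derivative_def)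
  qed
  have "f differentiable (at x) \<longleftrightarrow> g differentiable (at x)" if "x \<in> S" for x
    using that Suc.prems assms(1) unfolding differentiable_def
    by (metis has_derivative_transform_within_open)
  moreover have "cont_diff_on k S (\<lambda>x. frechet_derivative f (at x) h) \<longleftrightarrow>
      cont_diff_on k S (\<lambda>x. frechet_derivative g (at x) h)" for h
    by (rule Suc.IH) (simp add: D)
  ultimately show ?case by simp
qed

lemma cont_diff_on_SucD: "cont_diff_on (Suc k) S f \<Longrightarrow> cont_diff_on k S f"
proof (induction k arbitrary: f)
  case 0
  then show ?case
    by (auto intro!: continuous_at_imp_continuous_on differentiable_imp_continuous_within)
next
  case (Suc k)
  then show ?case unfolding cont_diff_on.simps(2)[of "Suc k"] by (subst cont_diff_on.simps(2)) blast
qed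

text \<open>Derivatives are unique on an open set, so any expression \<open>D\<close> found by calculation may replace
  the choice made by \<open>frechet_derivative\<close>.\<close>

lemma cont_diff_on_SucI:
  assumes "open S" "\<And>x. x \<in> S \<Longrightarrow> (f has_derivative D x) (at x)"
    and "\<And>h. cont_diff_on k S (\<lambda>x. D x h)"
  shows "cont_diff_on (Suc k) S f"
proof -
  have "frechet_derivative f (at x) = D x" if "x \<in> S" for x
    using assms(2)[OF that] by (metis frechet_derivative_at)
  then have "cont_diff_on k S (\<lambda>x. frechet_derivative f (at x) h)" for h
    using assms(3)[of h]
      cont_diff_on_cong[OF assms(1), of "\<lambda>x. frechet_derivative f (at x) h" "\<lambda>x. D x h" k] by simp
  then show ?thesis using assms(2) by (auto simp: differentiable_def)
qed

lemma cont_diff_on_Suc_derivative: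
  assumes "cont_diff_on (Suc k) S f"
  shows "\<exists>D. (\<forall>x\<in>S. (f has_derivative D x) (at x)) \<and> (\<forall>h. cont_diff_on k S (\<lambda>x. D x h))"
  using assms by (intro exI[of _ "\<lambda>x. frechet_derivative f (at x)"]) (simp add: frechet_derivative_works)

lemma cont_diff_on_const: "open S \<Longrightarrow> cont_diff_on k S (\<lambda>x. c)"
  by (induction k arbitrary: c) (auto intro!: continuous_intros)

lemma cont_diff_on_bounded_linear:
  assumes "open S" "cont_diff_on k S f" "bounded_linear L"
  shows "cont_diff_on k S (\<lambda>x. L (f x))"
  using assms(2)
proof (induction k arbitrary: f)
  case 0 then show ?case using assms(3) by (auto intro: bounded_linear.continuous_on)
next
  case (Suc k)
  from Suc.prems obtain D where D: "\<And>x. x \<in> S \<Longrightarrow> (f has_derivative D x) (at x)"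
    "\<And>h. cont_diff_on k S (\<lambda>x. D x h)" by (blast dest!: cont_diff_on_Suc_derivative)
  show ?case
    by (rule cont_diff_on_SucI[where D="\<lambda>x h. L (D x h)"])
      (auto intro!: assms D Suc.IH bounded_linear.has_derivative[OF assms(3)])
qed

lemma cont_diff_on_add:
  assumes "open S" "cont_diff_on k S f" "cont_diff_on k S g"
  shows "cont_diff_on k S (\<lambda>x. f x + g x)"
  using assms(2,3)
proof (induction k arbitrary: f g)
  case 0 then show ?case by (auto intro: continuous_intros)
next
  case (Suc k)
  from Suc.prems(1) obtain D where D: "\<And>x. x \<in> S \<Longrightarrow> (f has_derivative D x) (at x)"
    "\<And>h. cont_diff_on k S (\<lambda>x. D x h)" by (blast dest!: cont_diff_on_Suc_derivative)
  from Suc.prems(2) obtain E where E: "\<And>x. x \<in> S \<Longrightarrow> (g has_derivative E x) (at x)"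
    "\<And>h. cont_diff_on k S (\<lambda>x. E x h)" by (blast dest!: cont_diff_on_Suc_derivative)
  show ?case
    by (rule cont_diff_on_SucI[where D="\<lambda>x h. D x h + E x h"])
      (auto intro!: assms D E Suc.IH has_derivative_add)
qed

lemma cont_diff_on_mult:
  fixes f g :: "'a::euclidean_space \<Rightarrow> real"
  assumes "open S" "cont_diff_on k S f" "cont_diff_on k S g"
  shows "cont_diff_on k S (\<lambda>x. f x * g x)"
  using assms(2,3)
proof (induction k arbitrary: f g)
  case 0 then show ?case by (auto intro: continuous_intros)
next
  case (Suc k)
  from Suc.prems(1) obtain D where D: "\<And>x. x \<in> S \<Longrightarrow> (f has_derivative D x) (at x)"
    "\<And>h. cont_diff_on k S (\<lambda>x. D x h)" by (blast dest!: cont_diff_on_Suc_derivative)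
  from Suc.prems(2) obtain E where E: "\<And>x. x \<in> S \<Longrightarrow> (g has_derivative E x) (at x)"
    "\<And>h. cont_diff_on k S (\<lambda>x. E x h)" by (blast dest!: cont_diff_on_Suc_derivative)
  show ?case
    by (rule cont_diff_on_SucI[where D="\<lambda>x h. f x * E x h + D x h * g x"])
      (auto intro!: assms D E Suc.IH has_derivative_mult cont_diff_on_add Suc.prems[THEN cont_diff_on_SucD])
qed

lemma cont_diff_on_sum:
  assumes "open S" "\<And>i. i \<in> I \<Longrightarrow> cont_diff_on k S (f i)"
  shows "cont_diff_on k S (\<lambda>x. \<Sum>i\<in>I. f i x)"
  using assms(2)
  by (induction I rule: infinite_finite_induct)
    (auto intro!: cont_diff_on_const cont_diff_on_add assms(1))

lemma cont_diff_on_scaleR_const: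
  fixes f :: "'a::euclidean_space \<Rightarrow> real"
  assumes "open S" "cont_diff_on k S f"
  shows "cont_diff_on k S (\<lambda>x. f x *\<^sub>R c)"
  by (rule cont_diff_on_bounded_linear[OF assms bounded_linear_scaleR_left])

lemma cont_diff_on_scaleR:
  fixes f :: "'a::euclidean_space \<Rightarrow> real" and g :: "'a \<Rightarrow> 'b::euclidean_space"
  assumes "open S" "cont_diff_on k S f" "cont_diff_on k S g"
  shows "cont_diff_on k S (\<lambda>x. f x *\<^sub>R g x)"
proof -
  have *: "f x *\<^sub>R g x = (\<Sum>b\<in>Basis. (f x * (g x \<bullet> b)) *\<^sub>R b)" for x
    using euclidean_representation[of "f x *\<^sub>R g x"] by simp
  show ?thesis unfolding *
    by (intro cont_diff_on_sum cont_diff_on_scaleR_const cont_diff_on_mult assms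
        cont_diff_on_bounded_linear[OF assms(1,3)] bounded_linear_inner_left)
qed

text \<open>By the chain rule \<open>D (f \<circ> g) h = (\<Sum>b. (D g h \<bullet> b) *\<^sub>R (D f b \<circ> g))\<close>, whose right side only
  involves compositions one degree lower.\<close>

lemma cont_diff_on_compose:
  fixes g :: "'a::euclidean_space \<Rightarrow> 'b::euclidean_space" and f :: "'b \<Rightarrow> 'c::euclidean_space"
  assumes "open S" "open T" "g ` S \<subseteq> T" "cont_diff_on k S g" "cont_diff_on k T f"
  shows "cont_diff_on k S (\<lambda>x. f (g x))"
  using assms(4,5)
proof (induction k arbitrary: f)
  case 0 then show ?case using assms(3) by (auto intro: continuous_on_compose2)
next
  case (Suc k)
  from Suc.prems(1) obtain D where D: "\<And>x. x \<in> S \<Longrightarrow> (g has_derivative D x) (at x)"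
    "\<And>h. cont_diff_on k S (\<lambda>x. D x h)" by (blast dest!: cont_diff_on_Suc_derivative)
  from Suc.prems(2) obtain E where E: "\<And>x. x \<in> T \<Longrightarrow> (f has_derivative E x) (at x)"
    "\<And>h. cont_diff_on k T (\<lambda>x. E x h)" by (blast dest!: cont_diff_on_Suc_derivative)
  show ?case
  proof (rule cont_diff_on_SucI[OF assms(1), where D="\<lambda>x h. \<Sum>b\<in>Basis. (D x h \<bullet> b) *\<^sub>R E (g x) b"])
    fix x assume x: "x \<in> S"
    have "((\<lambda>x. f (g x)) has_derivative (\<lambda>h. E (g x) (D x h))) (at x)"
      using has_derivative_compose[OF D(1)[OF x], of f "E (g x)"] E x assms(3) by blast
    moreover have "E (g x) (D x h) = (\<Sum>b\<in>Basis. (D x h \<bullet> b) *\<^sub>R E (g x) b)" for h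
    proof -
      have "linear (E (g x))"
        using E(1)[of "g x"] x assms(3) by (auto dest: has_derivative_linear)
      then have "E (g x) (\<Sum>b\<in>Basis. (D x h \<bullet> b) *\<^sub>R b) = (\<Sum>b\<in>Basis. (D x h \<bullet> b) *\<^sub>R E (g x) b)"
        by (simp add: linear_sum linear_scale)
      then show ?thesis by (simp only: euclidean_representation)
    qed
    ultimately show "((\<lambda>x. f (g x)) has_derivative (\<lambda>h. \<Sum>b\<in>Basis. (D x h \<bullet> b) *\<^sub>R E (g x) b)) (at x)"
      by simp
  next
    fix h
    show "cont_diff_on k S (\<lambda>x. \<Sum>b\<in>Basis. (D x h \<bullet> b) *\<^sub>R E (g x) b)"
      by (intro cont_diff_on_sum cont_diff_on_scaleR Suc.IH assms(1) E
          cont_diff_on_SucD[OF Suc.prems(1)] cont_diff_on_bounded_linear[OF assms(1) D(2)]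
          bounded_linear_inner_left)
  qed
qed

lemma cont_diff_on_local:
  assumes "\<And>x. x \<in> S \<Longrightarrow> \<exists>U. open U \<and> x \<in> U \<and> cont_diff_on k U f"
  shows "cont_diff_on k S f"
  using assms
proof (induction k arbitrary: f)
  case 0
  have "isCont f x" if "x \<in> S" for x
    using 0[OF that] by (auto simp: continuous_on_eq_continuous_at)
  then show ?case by (simp add: continuous_at_imp_continuous_on)
next
  case (Suc k)
  have "f differentiable (at x)" if "x \<in> S" for x
    using Suc.prems[OF that] by auto
  moreover have "cont_diff_on k S (\<lambda>x. frechet_derivative f (at x) h)" for h
    by (rule Suc.IH) (use Suc.prems in fastforce)
  ultimately show ?case by simp
qed

lemma smooth_on_subset: "smooth_on T f \<Longrightarrow> S \<subseteq> T \<Longrightarrow> smooth_on S f"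
  by (auto simp: smooth_on_def intro: cont_diff_on_subset)

lemma smooth_on_cong: "open S \<Longrightarrow> (\<And>x. x \<in> S \<Longrightarrow> f x = g x) \<Longrightarrow> smooth_on S f \<longleftrightarrow> smooth_on S g"
  unfolding smooth_on_def using cont_diff_on_cong by blast

lemma smooth_on_const: "open S \<Longrightarrow> smooth_on S (\<lambda>x. c)"
  by (simp add: smooth_on_def cont_diff_on_const)

lemma smooth_on_bounded_linear:
  "open S \<Longrightarrow> smooth_on S f \<Longrightarrow> bounded_linear L \<Longrightarrow> smooth_on S (\<lambda>x. L (f x))"
  by (simp add: smooth_on_def cont_diff_on_bounded_linear)

lemma smooth_on_add: "open S \<Longrightarrow> smooth_on S f \<Longrightarrow> smooth_on S g \<Longrightarrow> smooth_on S (\<lambda>x. f x + g x)"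
  by (simp add: smooth_on_def cont_diff_on_add)

lemma smooth_on_mult:
  fixes f g :: "'a::euclidean_space \<Rightarrow> real"
  shows "open S \<Longrightarrow> smooth_on S f \<Longrightarrow> smooth_on S g \<Longrightarrow> smooth_on S (\<lambda>x. f x * g x)"
  by (simp add: smooth_on_def cont_diff_on_mult)

lemma smooth_on_diff:
  assumes "open S" "smooth_on S f" "smooth_on S g"
  shows "smooth_on S (\<lambda>x. f x - g x)"
  using smooth_on_add[OF assms(1,2) smooth_on_bounded_linear[OF assms(1,3), of uminus]]
  by (simp add: bounded_linear_minus bounded_linear_ident)

lemma smooth_on_sum:
  "open S \<Longrightarrow> (\<And>i. i \<in> I \<Longrightarrow> smooth_on S (f i)) \<Longrightarrow> smooth_on S (\<lambda>x. \<Sum>i\<in>I. f i x)"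
  by (simp add: smooth_on_def cont_diff_on_sum)

lemma smooth_on_compose:
  fixes g :: "'a::euclidean_space \<Rightarrow> 'b::euclidean_space" and f :: "'b \<Rightarrow> 'c::euclidean_space"
  shows "open S \<Longrightarrow> open T \<Longrightarrow> g ` S \<subseteq> T \<Longrightarrow> smooth_on S g \<Longrightarrow> smooth_on T f \<Longrightarrow>
    smooth_on S (\<lambda>x. f (g x))"
  unfolding smooth_on_def using cont_diff_on_compose[of S T g] by blast

lemma smooth_on_local:
  "(\<And>x. x \<in> S \<Longrightarrow> \<exists>U. open U \<and> x \<in> U \<and> smooth_on U f) \<Longrightarrow> smooth_on S f"
  unfolding smooth_on_def using cont_diff_on_local by metis

lemma smooth_on_continuous: "smooth_on S f \<Longrightarrow> continuous_on S f"
  unfolding smooth_on_def using cont_diff_on.simps(1) by blast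

lemma smooth_on_has_derivative:
  "smooth_on S f \<Longrightarrow> x \<in> S \<Longrightarrow> (f has_derivative frechet_derivative f (at x)) (at x)"
  unfolding smooth_on_def using cont_diff_on.simps(2) by (metis frechet_derivative_works)

lemma smooth_on_frechet_derivative:
  "smooth_on S f \<Longrightarrow> smooth_on S (\<lambda>x. frechet_derivative f (at x) h)"
  unfolding smooth_on_def using cont_diff_on.simps(2) by blast

lemma smooth_on_ident: "open S \<Longrightarrow> smooth_on S (\<lambda>x. x)"
  unfolding smooth_on_def
proof
  fix k assume S: "open S"
  show "cont_diff_on k S (\<lambda>x. x)"
  proof (cases k)
    case (Suc j)
    then show ?thesis
      using S by (auto intro!: cont_diff_on_SucI[where D="\<lambda>x h. h"] derivative_eq_intros cont_diff_on_const)
  qed simp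
qed

section \<open>Symmetry of second derivatives\<close>

text \<open>The second difference quotient is symmetric in \<open>h\<close> and \<open>k\<close>, and the mean value theorem, applied in
  direction \<open>h\<close> and then in direction \<open>k\<close>, turns it into a second derivative at a nearby point.\<close>

lemma second_difference:
  fixes f :: "'a::euclidean_space \<Rightarrow> real"
  assumes S: "smooth_on S f" "ball x d \<subseteq> S" and r: "0 < r" "r * (norm h + norm k) < d"
  shows "\<exists>y\<in>ball x d. f (x + r *\<^sub>R h + r *\<^sub>R k) - f (x + r *\<^sub>R h) - f (x + r *\<^sub>R k) + f x =
    r\<^sup>2 * frechet_derivative (\<lambda>z. frechet_derivative f (at z) h) (at y) k"
proof -
  define Dh where "Dh z = frechet_derivative f (at z) h" for z
  have inb: "x + s *\<^sub>R h + t *\<^sub>R k \<in> ball x d" if "0 \<le> s" "s \<le> r" "0 \<le> t" "t \<le> r" for s t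
  proof -
    have "norm (s *\<^sub>R h + t *\<^sub>R k) \<le> s * norm h + t * norm k"
      using norm_triangle_ineq[of "s *\<^sub>R h" "t *\<^sub>R k"] that by simp
    also have "\<dots> \<le> r * (norm h + norm k)"
      using that by (simp add: distrib_left add_mono mult_right_mono)
    finally have "norm (s *\<^sub>R h + t *\<^sub>R k) < d" using r by simp
    moreover have "dist x (x + s *\<^sub>R h + t *\<^sub>R k) = norm (s *\<^sub>R h + t *\<^sub>R k)"
      unfolding dist_commute[of x] by (simp add: dist_norm add.assoc)
    ultimately show ?thesis by simp
  qed
  have smD: "smooth_on S Dh" unfolding Dh_def by (rule smooth_on_frechet_derivative[OF S(1)])
  have line: "((\<lambda>s. F (a + s *\<^sub>R v)) has_real_derivative frechet_derivative F (at (a + s *\<^sub>R v)) v) (at s)"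
    if "smooth_on S F" "a + s *\<^sub>R v \<in> S" for F :: "'a \<Rightarrow> real" and a v s
  proof -
    have d: "(F has_derivative frechet_derivative F (at (a + s *\<^sub>R v))) (at (a + s *\<^sub>R v))"
      using smooth_on_has_derivative that by blast
    have l: "((\<lambda>s. a + s *\<^sub>R v) has_derivative (\<lambda>s. s *\<^sub>R v)) (at s)"
      by (auto intro!: derivative_eq_intros)
    have "((\<lambda>s. F (a + s *\<^sub>R v)) has_derivative
        (\<lambda>t. frechet_derivative F (at (a + s *\<^sub>R v)) (t *\<^sub>R v))) (at s)"
      using has_derivative_compose[OF l d] by simp
    moreover have "frechet_derivative F (at (a + s *\<^sub>R v)) (t *\<^sub>R v) =
        frechet_derivative F (at (a + s *\<^sub>R v)) v * t" for t
      using has_derivative_linear[OF d] by (simp add: linear_scale)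
    ultimately show ?thesis by (simp add: has_field_derivative_def)
  qed
  define u where "u s = f ((x + r *\<^sub>R k) + s *\<^sub>R h) - f (x + s *\<^sub>R h)" for s
  have "\<exists>z>0. z < r \<and> u r - u 0 = (r - 0) * (Dh (x + r *\<^sub>R k + z *\<^sub>R h) - Dh (x + z *\<^sub>R h))"
  proof (rule MVT2)
    fix s assume s: "0 \<le> s" "s \<le> r"
    have "(x + r *\<^sub>R k) + s *\<^sub>R h \<in> S" "x + s *\<^sub>R h \<in> S"
      using inb[of s r] inb[of s 0] s r S(2) by (auto simp: ac_simps)
    then show "(u has_real_derivative Dh (x + r *\<^sub>R k + s *\<^sub>R h) - Dh (x + s *\<^sub>R h)) (at s)"
      unfolding u_def Dh_def by (intro DERIV_diff line[OF S(1)])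
  qed (use r in simp)
  then obtain z where z: "0 < z" "z < r"
    and u: "u r - u 0 = r * (Dh ((x + z *\<^sub>R h) + r *\<^sub>R k) - Dh ((x + z *\<^sub>R h) + 0 *\<^sub>R k))"
    by (auto simp: ac_simps)
  have "\<exists>w>0. w < r \<and> Dh ((x + z *\<^sub>R h) + r *\<^sub>R k) - Dh ((x + z *\<^sub>R h) + 0 *\<^sub>R k) =
      (r - 0) * frechet_derivative Dh (at ((x + z *\<^sub>R h) + w *\<^sub>R k)) k"
  proof (rule MVT2)
    fix s assume s: "0 \<le> s" "s \<le> r"
    have "(x + z *\<^sub>R h) + s *\<^sub>R k \<in> S" using inb[of z s] s z S(2) by auto
    then show "((\<lambda>s. Dh ((x + z *\<^sub>R h) + s *\<^sub>R k)) has_real_derivative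
        frechet_derivative Dh (at ((x + z *\<^sub>R h) + s *\<^sub>R k)) k) (at s)"
      by (intro line[OF smD])
  qed (use r in simp)
  then obtain w where w: "0 < w" "w < r"
    and v: "Dh ((x + z *\<^sub>R h) + r *\<^sub>R k) - Dh ((x + z *\<^sub>R h) + 0 *\<^sub>R k) =
      r * frechet_derivative Dh (at ((x + z *\<^sub>R h) + w *\<^sub>R k)) k"
    by auto
  show ?thesis
  proof (rule bexI[of _ "x + z *\<^sub>R h + w *\<^sub>R k"])
    show "x + z *\<^sub>R h + w *\<^sub>R k \<in> ball x d" using inb z w by simp
    have "u r - u 0 = r\<^sup>2 * frechet_derivative Dh (at ((x + z *\<^sub>R h) + w *\<^sub>R k)) k"
      unfolding u v by (simp add: power2_eq_square)
    then show "f (x + r *\<^sub>R h + r *\<^sub>R k) - f (x + r *\<^sub>R h) - f (x + r *\<^sub>R k) + f x =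
        r\<^sup>2 * frechet_derivative (\<lambda>z. frechet_derivative f (at z) h) (at (x + z *\<^sub>R h + w *\<^sub>R k)) k"
      unfolding Dh_def[symmetric] by (simp add: u_def ac_simps)
  qed
qed

text \<open>Exchanging \<open>h\<close> and \<open>k\<close> in the second difference shows that the two mixed derivatives agree at
  points arbitrarily close to \<open>x\<close>; continuity carries this over to \<open>x\<close>.\<close>

lemma second_derivative_symmetric_real:
  fixes f :: "'a::euclidean_space \<Rightarrow> real"
  assumes S: "open S" "smooth_on S f" "x \<in> S"
  shows "frechet_derivative (\<lambda>z. frechet_derivative f (at z) h) (at x) k =
    frechet_derivative (\<lambda>z. frechet_derivative f (at z) k) (at x) h" (is "?P x = ?Q x")
proof (rule ccontr)
  define e where "e = \<bar>?P x - ?Q x\<bar> / 2"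
  assume "?P x \<noteq> ?Q x"
  then have e: "e > 0" by (simp add: e_def)
  have "isCont ?P x" "isCont ?Q x"
    using S by (auto simp: continuous_on_eq_continuous_at[symmetric]
        intro!: continuous_on_interior[where S=S] smooth_on_continuous smooth_on_frechet_derivative
        simp: interior_open)
  then obtain d1 d2 where d: "d1 > 0" "d2 > 0"
    "\<And>y. dist y x < d1 \<Longrightarrow> dist (?P y) (?P x) < e" "\<And>y. dist y x < d2 \<Longrightarrow> dist (?Q y) (?Q x) < e"
    using e unfolding continuous_at_eps_delta by metis
  obtain d3 where d3: "d3 > 0" "ball x d3 \<subseteq> S" using S open_contains_ball by blast
  (* The increments r h and r k have to stay in a ball on which both mixed derivatives vary by less than e. *)
  define D where "D = min d3 (min d1 d2)"
  define N where "N = norm h + norm k + 1"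
  define r where "r = D / N / 2"
  have D: "D > 0" using d d3 by (simp add: D_def)
  have n: "N > 0" by (simp add: N_def add_nonneg_pos)
  have r: "r > 0" using D n by (simp add: r_def)
  have "r * (norm h + norm k) < r * N" using r by (simp add: N_def)
  also have "\<dots> = D / 2" using n by (simp add: r_def)
  also have "\<dots> < D" using D by simp
  finally have r2: "r * (norm h + norm k) < D" .
  have bS: "ball x D \<subseteq> S" using d3 by (auto simp: D_def)
  obtain y where y: "y \<in> ball x D"
    "f (x + r *\<^sub>R h + r *\<^sub>R k) - f (x + r *\<^sub>R h) - f (x + r *\<^sub>R k) + f x = r\<^sup>2 * ?P y"
    using second_difference[OF S(2) bS r r2] by blast
  obtain z where z: "z \<in> ball x D"
    "f (x + r *\<^sub>R k + r *\<^sub>R h) - f (x + r *\<^sub>R k) - f (x + r *\<^sub>R h) + f x = r\<^sup>2 * ?Q z"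
    using second_difference[OF S(2) bS r, of k h] r2 by (auto simp: add.commute)
  have "r\<^sup>2 * ?P y = r\<^sup>2 * ?Q z" using y(2) z(2) by (simp add: algebra_simps)
  then have "?P y = ?Q z" using r by simp
  moreover have "\<bar>?P y - ?P x\<bar> < e" "\<bar>?Q z - ?Q x\<bar> < e"
    using d(3)[of y] d(4)[of z] y(1) z(1) by (auto simp: D_def dist_real_def dist_commute)
  moreover have "\<bar>?P x - ?Q x\<bar> = e + e" by (simp add: e_def)
  ultimately show False by (auto simp: abs_less_iff abs_if split: if_splits)
qed

lemma second_derivative_symmetric:
  fixes f :: "'a::euclidean_space \<Rightarrow> 'b::euclidean_space"
  assumes S: "open S" "smooth_on S f" "x \<in> S"
  shows "frechet_derivative (\<lambda>z. frechet_derivative f (at z) h) (at x) k =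
    frechet_derivative (\<lambda>z. frechet_derivative f (at z) k) (at x) h"
proof (rule euclidean_eqI)
  fix b :: 'b assume "b \<in> Basis"
  have inner: "frechet_derivative (\<lambda>z. g z \<bullet> b) (at y) k = frechet_derivative g (at y) k \<bullet> b"
    if "smooth_on S g" "y \<in> S" for g :: "'a \<Rightarrow> 'b" and y k
    using frechet_derivative_at[OF has_derivative_inner_left[OF smooth_on_has_derivative[OF that]]]
    by metis
  have sm: "smooth_on S (\<lambda>z. f z \<bullet> b)"
    by (rule smooth_on_bounded_linear[OF S(1,2) bounded_linear_inner_left])
  have "frechet_derivative (\<lambda>z. frechet_derivative f (at z) h) (at x) k \<bullet> b =
      frechet_derivative (\<lambda>z. frechet_derivative (\<lambda>z. f z \<bullet> b) (at z) h) (at x) k" for h k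
  proof -
    have "((\<lambda>z. frechet_derivative f (at z) h \<bullet> b) has_derivative
        (\<lambda>k. frechet_derivative (\<lambda>z. frechet_derivative f (at z) h) (at x) k \<bullet> b)) (at x)"
      by (rule has_derivative_inner_left[OF
            smooth_on_has_derivative[OF smooth_on_frechet_derivative[OF S(2)] S(3)]])
    then have "((\<lambda>z. frechet_derivative (\<lambda>z. f z \<bullet> b) (at z) h) has_derivative
        (\<lambda>k. frechet_derivative (\<lambda>z. frechet_derivative f (at z) h) (at x) k \<bullet> b)) (at x)"
      by (rule has_derivative_transform_within_open[OF _ S(1,3)]) (simp add: inner[OF S(2)])
    from frechet_derivative_at[OF this] show ?thesis by (rule fun_cong)
  qed
  then show "frechet_derivative (\<lambda>z. frechet_derivative f (at z) h) (at x) k \<bullet> b =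
      frechet_derivative (\<lambda>z. frechet_derivative f (at z) k) (at x) h \<bullet> b"
    using second_derivative_symmetric_real[OF S(1) sm S(3)] by simp
qed

section \<open>Families of bilinear forms\<close>

lemma bilinear_expand:
  fixes B :: "'a::euclidean_space \<Rightarrow> 'b::euclidean_space \<Rightarrow> real"
  assumes "bilinear B"
  shows "B h k = (\<Sum>E\<in>Basis. \<Sum>F\<in>Basis. (h \<bullet> E) * (k \<bullet> F) * B E F)"
proof -
  have "B h k = B (\<Sum>E\<in>Basis. (h \<bullet> E) *\<^sub>R E) (\<Sum>F\<in>Basis. (k \<bullet> F) *\<^sub>R F)"
    by (simp only: euclidean_representation)
  also have "\<dots> = (\<Sum>E\<in>Basis. \<Sum>F\<in>Basis. (h \<bullet> E) * (k \<bullet> F) * B E F)"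
    using assms
    by (subst bilinear_sum[OF assms])
      (simp add: sum.cartesian_product split_beta bilinear_lmul bilinear_rmul mult.assoc)
  finally show ?thesis .
qed

lemma smooth_on_bilinear_family:
  fixes \<beta> :: "'e::euclidean_space \<Rightarrow> 'e \<Rightarrow> 'a::euclidean_space \<Rightarrow> real" and u v :: "'a \<Rightarrow> 'e"
  assumes S: "open S" and B: "\<And>x. x \<in> S \<Longrightarrow> bilinear (\<lambda>h k. \<beta> h k x)"
    and "\<And>h k. smooth_on S (\<beta> h k)" "smooth_on S u" "smooth_on S v"
  shows "smooth_on S (\<lambda>x. \<beta> (u x) (v x) x)"
proof -
  have "smooth_on S (\<lambda>x. \<Sum>E\<in>Basis. \<Sum>F\<in>Basis. (u x \<bullet> E) * (v x \<bullet> F) * \<beta> E F x)"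
    by (intro smooth_on_sum smooth_on_mult assms smooth_on_bounded_linear[OF S _ bounded_linear_inner_left])
  then show ?thesis
    by (rule smooth_on_cong[OF S, THEN iffD1, rotated]) (rule bilinear_expand[OF B, symmetric])
qed

text \<open>Product rule for a bilinear form whose coefficients and arguments all vary.\<close>

lemma bilinear_family_has_derivative:
  fixes \<beta> :: "'e::euclidean_space \<Rightarrow> 'e \<Rightarrow> 'a::euclidean_space \<Rightarrow> real" and u v :: "'a \<Rightarrow> 'e"
  assumes S: "open S" "x \<in> S" and B: "\<And>x. x \<in> S \<Longrightarrow> bilinear (\<lambda>h k. \<beta> h k x)"
    and \<beta>: "\<And>h k. (\<beta> h k has_derivative \<beta>' h k) (at x)"
    and u: "(u has_derivative u') (at x)" and v: "(v has_derivative v') (at x)"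
  shows "((\<lambda>x. \<beta> (u x) (v x) x) has_derivative
    (\<lambda>l. \<beta>' (u x) (v x) l + \<beta> (u' l) (v x) x + \<beta> (u x) (v' l) x)) (at x)"
proof -
  have frozen: "\<beta>' h k l = (\<Sum>E\<in>Basis. \<Sum>F\<in>Basis. (h \<bullet> E) * (k \<bullet> F) * \<beta>' E F l)" for h k l
  proof -
    have "((\<lambda>x. \<Sum>E\<in>Basis. \<Sum>F\<in>Basis. (h \<bullet> E) * (k \<bullet> F) * \<beta> E F x) has_derivative
        (\<lambda>l. \<Sum>E\<in>Basis. \<Sum>F\<in>Basis. (h \<bullet> E) * (k \<bullet> F) * \<beta>' E F l)) (at x)"
      by (intro has_derivative_sum has_derivative_mult_right \<beta>)
    then have "(\<beta> h k has_derivative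
        (\<lambda>l. \<Sum>E\<in>Basis. \<Sum>F\<in>Basis. (h \<bullet> E) * (k \<bullet> F) * \<beta>' E F l)) (at x)"
      by (rule has_derivative_transform_within_open[OF _ S]) (rule bilinear_expand[OF B, symmetric])
    from has_derivative_unique[OF \<beta>[of h k] this] show ?thesis by (rule fun_cong)
  qed
  have "((\<lambda>x. \<Sum>E\<in>Basis. \<Sum>F\<in>Basis. (u x \<bullet> E) * (v x \<bullet> F) * \<beta> E F x) has_derivative
      (\<lambda>l. \<Sum>E\<in>Basis. \<Sum>F\<in>Basis. (u x \<bullet> E) * (v x \<bullet> F) * \<beta>' E F l
        + ((u x \<bullet> E) * (v' l \<bullet> F) + (u' l \<bullet> E) * (v x \<bullet> F)) * \<beta> E F x)) (at x)"
    by (intro has_derivative_sum has_derivative_mult \<beta> has_derivative_inner_left u v)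
  also have "(\<lambda>l. \<Sum>E\<in>Basis. \<Sum>F\<in>Basis. (u x \<bullet> E) * (v x \<bullet> F) * \<beta>' E F l
        + ((u x \<bullet> E) * (v' l \<bullet> F) + (u' l \<bullet> E) * (v x \<bullet> F)) * \<beta> E F x) =
      (\<lambda>l. \<beta>' (u x) (v x) l + \<beta> (u' l) (v x) x + \<beta> (u x) (v' l) x)"
  proof
    fix l
    show "(\<Sum>E\<in>Basis. \<Sum>F\<in>Basis. (u x \<bullet> E) * (v x \<bullet> F) * \<beta>' E F l
        + ((u x \<bullet> E) * (v' l \<bullet> F) + (u' l \<bullet> E) * (v x \<bullet> F)) * \<beta> E F x) =
      \<beta>' (u x) (v x) l + \<beta> (u' l) (v x) x + \<beta> (u x) (v' l) x"
      unfolding frozen[of "u x" "v x" l] bilinear_expand[OF B[OF S(2)], of "u' l" "v x"]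
        bilinear_expand[OF B[OF S(2)], of "u x" "v' l"]
      by (simp add: sum.distrib[symmetric] algebra_simps)
  qed
  finally show ?thesis
    by (rule has_derivative_transform_within_open[OF _ S]) (rule bilinear_expand[OF B, symmetric])
qed

text \<open>A positive definite form induces an injective, hence bijective, map to the dual space.\<close>

lemma riesz_bilinear:
  fixes B :: "'e::euclidean_space \<Rightarrow> 'e \<Rightarrow> real"
  assumes "bilinear B" and pos: "\<And>h. h \<noteq> 0 \<Longrightarrow> B h h > 0" and a: "linear a"
  shows "\<exists>u. \<forall>k. B u k = a k"
proof -
  define T where "T u = (\<Sum>E\<in>Basis. B u E *\<^sub>R E)" for u
  have lin: "linear T"
    unfolding T_def using assms(1)
    by (intro linearI) (simp_all add: bilinear_ladd bilinear_lmul algebra_simps sum.distrib scaleR_sum_right)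
  have lB: "linear (B u)" for u using assms(1) by (simp add: bilinear_def)
  have rep: "f k = (\<Sum>E\<in>Basis. f E *\<^sub>R E) \<bullet> k" if "linear f" for f :: "'e \<Rightarrow> real" and k
  proof -
    have "f k = f (\<Sum>E\<in>Basis. (k \<bullet> E) *\<^sub>R E)" by (simp only: euclidean_representation)
    then show ?thesis using that
      by (simp add: linear_sum linear_scale inner_sum_left inner_commute[of k] mult.commute)
  qed
  have T: "B u k = T u \<bullet> k" for u k unfolding T_def by (rule rep[OF lB])
  have "inj T"
    unfolding linear_injective_0[OF lin] using T pos by (metis inner_zero_left less_irrefl)
  then have "surj T" using lin linear_injective_imp_surjective by blast
  then obtain u where "T u = (\<Sum>E\<in>Basis. a E *\<^sub>R E)" by (metis surj_def)
  then have "B u k = a k" for k using T rep[OF a, of k] by simp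
  then show ?thesis by blast
qed

text \<open>Positive definiteness at one point gives, by compactness of the unit sphere, a uniform lower
  bound \<open>c * norm h ^ 2\<close> that survives nearby with \<open>c / 2\<close>; the difference of two solutions
  is then controlled by the differences of the data.\<close>

lemma riesz_solution_continuous:
  fixes B :: "'a::metric_space \<Rightarrow> 'e::euclidean_space \<Rightarrow> 'e \<Rightarrow> real"
  assumes S: "open S" "t0 \<in> S"
    and bil: "\<And>t. t \<in> S \<Longrightarrow> bilinear (B t)" and pos: "\<And>h. h \<noteq> 0 \<Longrightarrow> B t0 h h > 0"
    and lin: "\<And>t. t \<in> S \<Longrightarrow> linear (a t)"
    and cB: "\<And>h k. isCont (\<lambda>t. B t h k) t0" and ca: "\<And>h. isCont (\<lambda>t. a t h) t0"
    and u: "\<And>t k. t \<in> S \<Longrightarrow> B t (u t) k = a t k"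
  shows "isCont u t0"
proof -
  have "\<exists>c>0. \<forall>h. c * (norm h)\<^sup>2 \<le> B t0 h h"
  proof -
    have cont: "continuous_on (sphere 0 1) (\<lambda>h. B t0 h h)"
    proof -
      have eq: "(\<lambda>h. B t0 h h) = (\<lambda>h. \<Sum>E\<in>Basis. \<Sum>F\<in>Basis. (h \<bullet> E) * (h \<bullet> F) * B t0 E F)"
        by (intro ext bilinear_expand bil S)
      show ?thesis unfolding eq by (intro continuous_intros)
    qed
    obtain e :: 'e where "e \<in> Basis" using nonempty_Basis by blast
    then have "sphere (0::'e) 1 \<noteq> {}" by (metis norm_Basis mem_sphere_0 empty_iff)
    then obtain h0 where h0: "h0 \<in> sphere 0 1" "\<And>h. h \<in> sphere 0 1 \<Longrightarrow> B t0 h0 h0 \<le> B t0 h h"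
      using continuous_attains_inf[OF compact_sphere _ cont] by blast
    have scale: "B t0 (r *\<^sub>R y) (r *\<^sub>R y) = r\<^sup>2 * B t0 y y" for r y
      using bil[OF S(2)] by (simp add: bilinear_lmul bilinear_rmul power2_eq_square)
    have "B t0 h0 h0 > 0" using h0(1) pos[of h0] by fastforce
    moreover have "B t0 h0 h0 * (norm h)\<^sup>2 \<le> B t0 h h" for h
    proof (cases "h = 0")
      case True
      then show ?thesis using bil[OF S(2)] by (simp add: bilinear_lzero)
    next
      case False
      have "B t0 h h = (norm h)\<^sup>2 * B t0 (h /\<^sub>R norm h) (h /\<^sub>R norm h)"
        using scale[of "norm h" "h /\<^sub>R norm h"] False by simp
      then show ?thesis
        using h0(2)[of "h /\<^sub>R norm h"] False by (simp add: mult.commute mult_left_mono)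
    qed
    ultimately show ?thesis by blast
  qed
  then obtain c where c: "c > 0" "\<And>h. c * (norm h)\<^sup>2 \<le> B t0 h h" by blast
  (* delta and eta measure the change of the form and of the equation solved by u t0. *)
  define \<delta> where "\<delta> t = (\<Sum>E\<in>Basis. \<Sum>F\<in>Basis. \<bar>B t E F - B t0 E F\<bar>)" for t
  define \<eta> where "\<eta> t = (\<Sum>E\<in>Basis. \<bar>a t E - a t0 E\<bar> + \<bar>B t (u t0) E - B t0 (u t0) E\<bar>)" for t
  have "isCont \<delta> t0" unfolding \<delta>_def by (intro continuous_intros cB)
  then have "(\<delta> \<longlongrightarrow> 0) (at t0)" by (simp add: isCont_def \<delta>_def)
  then have ev1: "\<forall>\<^sub>F t in at t0. \<delta> t < c / 2" by (rule order_tendstoD) (use c in simp)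
  have "isCont \<eta> t0" unfolding \<eta>_def by (intro continuous_intros cB ca)
  then have \<eta>0: "(\<eta> \<longlongrightarrow> 0) (at t0)" by (simp add: isCont_def \<eta>_def)
  have ev2: "\<forall>\<^sub>F t in at t0. t \<in> S" using S eventually_at_topological by blast
  have "\<forall>\<^sub>F t in at t0. norm (u t - u t0) \<le> (2 / c) * \<eta> t"
    using ev1 ev2
  proof eventually_elim
    case (elim t)
    define w where "w = u t - u t0"
    note bt = bil[OF elim(2)] and b0 = bil[OF S(2)]
    have "\<bar>B t w w - B t0 w w\<bar> \<le> \<delta> t * (norm w)\<^sup>2"
    proof -
      have "B t w w - B t0 w w = (\<Sum>E\<in>Basis. \<Sum>F\<in>Basis. (w \<bullet> E) * (w \<bullet> F) * (B t E F - B t0 E F))"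
        unfolding bilinear_expand[OF bt, of w w] bilinear_expand[OF b0, of w w]
        by (simp add: sum_subtractf[symmetric] algebra_simps)
      also have "\<bar>\<dots>\<bar> \<le> (\<Sum>E\<in>Basis. \<Sum>F\<in>Basis. (norm w)\<^sup>2 * \<bar>B t E F - B t0 E F\<bar>)"
      proof (rule order_trans[OF sum_abs], rule sum_mono, rule order_trans[OF sum_abs], rule sum_mono)
        fix E F :: 'e assume "E \<in> Basis" "F \<in> Basis"
        then have "\<bar>w \<bullet> E\<bar> * \<bar>w \<bullet> F\<bar> \<le> norm w * norm w"
          by (intro mult_mono) (auto simp: Basis_le_norm)
        then show "\<bar>(w \<bullet> E) * (w \<bullet> F) * (B t E F - B t0 E F)\<bar> \<le> (norm w)\<^sup>2 * \<bar>B t E F - B t0 E F\<bar>"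
          by (simp add: abs_mult power2_eq_square mult_right_mono)
      qed
      also have "\<dots> = \<delta> t * (norm w)\<^sup>2" by (simp add: \<delta>_def sum_distrib_left mult.commute)
      finally show ?thesis .
    qed
    moreover have "\<delta> t * (norm w)\<^sup>2 \<le> c / 2 * (norm w)\<^sup>2"
      using elim(1) by (intro mult_right_mono) auto
    ultimately have low: "c / 2 * (norm w)\<^sup>2 \<le> B t w w" using c(2)[of w] by linarith
    have "B t w w = (a t w - a t0 w) - (B t (u t0) w - B t0 (u t0) w)"
      using u[OF elim(2), of w] u[OF S(2), of w] bilinear_lsub[OF bt, of "u t" "u t0" w]
      by (simp add: w_def)
    also have "\<dots> = (\<Sum>E\<in>Basis. (w \<bullet> E) * ((a t E - a t0 E) - (B t (u t0) E - B t0 (u t0) E)))"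
    proof -
      have "linear (\<lambda>w. (a t w - a t0 w) - (B t (u t0) w - B t0 (u t0) w))"
        using lin[OF elim(2)] lin[OF S(2)] bt b0
        by (intro linear_compose_sub) (auto simp: bilinear_def)
      from linear_sum[OF this, of "\<lambda>E. (w \<bullet> E) *\<^sub>R E" Basis]
      show ?thesis using linear_scale[OF \<open>linear _\<close>] by (simp add: euclidean_representation)
    qed
    also have "\<dots> \<le> (\<Sum>E\<in>Basis. norm w * (\<bar>a t E - a t0 E\<bar> + \<bar>B t (u t0) E - B t0 (u t0) E\<bar>))"
    proof (rule sum_mono)
      fix E :: 'e assume E: "E \<in> Basis"
      have "(w \<bullet> E) * ((a t E - a t0 E) - (B t (u t0) E - B t0 (u t0) E)) \<le>
          \<bar>w \<bullet> E\<bar> * \<bar>(a t E - a t0 E) - (B t (u t0) E - B t0 (u t0) E)\<bar>"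
        by (metis abs_ge_self abs_mult)
      also have "\<dots> \<le> norm w * (\<bar>a t E - a t0 E\<bar> + \<bar>B t (u t0) E - B t0 (u t0) E\<bar>)"
        using E by (intro mult_mono) (auto simp: Basis_le_norm)
      finally show "(w \<bullet> E) * ((a t E - a t0 E) - (B t (u t0) E - B t0 (u t0) E)) \<le>
          norm w * (\<bar>a t E - a t0 E\<bar> + \<bar>B t (u t0) E - B t0 (u t0) E\<bar>)" .
    qed
    also have "\<dots> = norm w * \<eta> t" by (simp add: \<eta>_def sum_distrib_left)
    finally have "norm w * (c / 2 * norm w) \<le> norm w * \<eta> t"
      using low by (simp add: power2_eq_square algebra_simps)
    moreover have "\<eta> t \<ge> 0" by (simp add: \<eta>_def sum_nonneg)
    ultimately have "c / 2 * norm w \<le> \<eta> t"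
      by (cases "w = 0") (auto simp: mult_le_cancel_left)
    then show ?case using c(1) by (simp add: w_def field_simps)
  qed
  then have "((\<lambda>t. u t - u t0) \<longlongrightarrow> 0) (at t0)"
    by (rule Lim_null_comparison) (rule tendsto_mult_right_zero[OF \<eta>0])
  then show ?thesis by (simp add: isCont_def LIM_zero_iff)
qed

section \<open>Charts and smooth maps into a manifold\<close>

lemma topspace_atlas_topology: "topspace (atlas_topology A) = carrier_of A"
proof -
  have "m \<in> \<Union> {{m \<in> cdom c. cmap c m \<in> V} |c V. c \<in> A \<and> open V}" if "c \<in> A" "m \<in> cdom c" for c m
    using that by (intro UnionI[of "{m \<in> cdom c. cmap c m \<in> UNIV}"]) blast+
  then show ?thesis
    unfolding atlas_topology_def topology_generated_by_topspace carrier_of_def by blast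
qed

lemma smooth_into_carrier:
  assumes "smooth_into A S f" "x \<in> S"
  obtains c where "c \<in> A" "f x \<in> cdom c"
proof -
  have "f x \<in> topspace (atlas_topology A)"
    using assms unfolding smooth_into_def by (auto simp: continuous_map_def)
  then show ?thesis using that unfolding topspace_atlas_topology carrier_of_def by blast
qed

lemma smooth_into_carrier_of:
  assumes "smooth_into A S f" "x \<in> S"
  shows "f x \<in> carrier_of A"
proof -
  obtain c where "c \<in> A" "f x \<in> cdom c" using smooth_into_carrier[OF assms] .
  then show ?thesis unfolding carrier_of_def by blast
qed

lemma smooth_into_open:
  assumes "smooth_into A S f" "open S" "c \<in> A"
  shows "open {x \<in> S. f x \<in> cdom c}"
proof -
  have "openin (atlas_topology A) {m \<in> cdom c. cmap c m \<in> UNIV}"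
    unfolding atlas_topology_def using assms(3)
    by (intro topology_generated_by_Basis) blast
  then have "openin (top_of_set S) {x \<in> S. f x \<in> cdom c}"
    using assms(1) openin_continuous_map_preimage[of "top_of_set S" "atlas_topology A" f "cdom c"]
    unfolding smooth_into_def by simp
  then show ?thesis using assms(2) openin_open_trans by blast
qed

lemma smooth_into_smooth:
  "smooth_into A S f \<Longrightarrow> c \<in> A \<Longrightarrow> smooth_on {x \<in> S. f x \<in> cdom c} (\<lambda>x. cmap c (f x))"
  by (simp add: smooth_into_def comp_def)

text \<open>Over an open parameter set, openness of the preimages of the chart domains already gives continuity,
  because smooth coordinate expressions are continuous.\<close>

lemma smooth_intoI:
  assumes "open S" "\<And>x. x \<in> S \<Longrightarrow> f x \<in> carrier_of A"
    and op: "\<And>c. c \<in> A \<Longrightarrow> open {x \<in> S. f x \<in> cdom c}"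
    and sm: "\<And>c. c \<in> A \<Longrightarrow> smooth_on {x \<in> S. f x \<in> cdom c} (\<lambda>x. cmap c (f x))"
  shows "smooth_into A S f"
  unfolding smooth_into_def
proof
  show "continuous_map (top_of_set S) (atlas_topology A) f"
    unfolding atlas_topology_def
  proof (rule continuous_on_generated_topo)
    fix U assume "U \<in> {{m \<in> cdom c. cmap c m \<in> V} |c V. c \<in> A \<and> open V}"
    then obtain c V where c: "c \<in> A" "open V" "U = {m \<in> cdom c. cmap c m \<in> V}" by blast
    have "open ({x \<in> S. f x \<in> cdom c} \<inter> (\<lambda>x. cmap c (f x)) -` V)"
      using continuous_open_preimage[OF smooth_on_continuous[OF sm] op] c by blast
    moreover have "{x \<in> S. f x \<in> cdom c} \<inter> (\<lambda>x. cmap c (f x)) -` V = f -` U \<inter> S"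
      unfolding c(3) by auto
    ultimately show "openin (top_of_set S) (f -` U \<inter> topspace (top_of_set S))"
      by (simp add: openin_open_eq[OF assms(1)])
  next
    show "f ` topspace (top_of_set S) \<subseteq> \<Union> {{m \<in> cdom c. cmap c m \<in> V} |c V. c \<in> A \<and> open V}"
      using assms(2) topspace_atlas_topology[of A]
      unfolding atlas_topology_def topology_generated_by_topspace by auto
  qed
qed (use sm in \<open>simp add: comp_def\<close>)

lemma smooth_into_compose:
  fixes L :: "'a::euclidean_space \<Rightarrow> 'b::euclidean_space"
  assumes f: "smooth_into A S f" and S: "open S" and T: "open T" and L: "smooth_on T L" "L ` T \<subseteq> S"
  shows "smooth_into A T (\<lambda>x. f (L x))"
proof (rule smooth_intoI[OF T])
  show "f (L x) \<in> carrier_of A" if "x \<in> T" for x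
    using that L(2) smooth_into_carrier[OF f, of "L x"] by (auto simp: carrier_of_def)
  fix c assume c: "c \<in> A"
  have eq: "{x \<in> T. f (L x) \<in> cdom c} = T \<inter> L -` {y \<in> S. f y \<in> cdom c}"
    using L(2) by auto
  show o: "open {x \<in> T. f (L x) \<in> cdom c}"
    unfolding eq
    by (rule continuous_open_preimage[OF smooth_on_continuous[OF L(1)] T smooth_into_open[OF f S c]])
  show "smooth_on {x \<in> T. f (L x) \<in> cdom c} (\<lambda>x. cmap c (f (L x)))"
    by (rule smooth_on_compose[OF o smooth_into_open[OF f S c] _ _ smooth_into_smooth[OF f c]])
      (use L in \<open>auto intro: smooth_on_subset\<close>)
qed

section \<open>Tangent vectors\<close>

lemma transition_derivative:
  assumes "complex_manifold A" "c \<in> A" "d \<in> A" "m \<in> cdom c" "m \<in> cdom d"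
  shows transition_has_derivative: "((cmap d \<circ> cinv c) has_derivative
      frechet_derivative (cmap d \<circ> cinv c) (at (cmap c m))) (at (cmap c m))"
    and transition_complex_linear: "frechet_derivative (cmap d \<circ> cinv c) (at (cmap c m)) (\<i> *s h) =
      \<i> *s frechet_derivative (cmap d \<circ> cinv c) (at (cmap c m)) h"
proof -
  have "vec_holomorphic_on (cmap d \<circ> cinv c) (cmap c ` (cdom c \<inter> cdom d))"
    using assms unfolding complex_manifold_def by blast
  then obtain D where "((cmap d \<circ> cinv c) has_derivative D) (at (cmap c m))"
    and "\<forall>h. D (\<i> *s h) = \<i> *s D h"
    using assms unfolding vec_holomorphic_on_def by blast
  then show "((cmap d \<circ> cinv c) has_derivative
      frechet_derivative (cmap d \<circ> cinv c) (at (cmap c m))) (at (cmap c m))"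
    and "frechet_derivative (cmap d \<circ> cinv c) (at (cmap c m)) (\<i> *s h) =
      \<i> *s frechet_derivative (cmap d \<circ> cinv c) (at (cmap c m)) h"
    using frechet_derivative_at by metis+
qed

lemma cinv_cmap: "complex_manifold A \<Longrightarrow> c \<in> A \<Longrightarrow> m \<in> cdom c \<Longrightarrow> cinv c (cmap c m) = m"
  unfolding complex_manifold_def by (simp add: inv_into_f_f)

lemma open_overlap: "complex_manifold A \<Longrightarrow> c \<in> A \<Longrightarrow> d \<in> A \<Longrightarrow> open (cmap c ` (cdom c \<inter> cdom d))"
  unfolding complex_manifold_def by blast

lemma open_chart_image: "complex_manifold A \<Longrightarrow> c \<in> A \<Longrightarrow> open (cmap c ` cdom c)"
  unfolding complex_manifold_def by blast

text \<open>The chain rule for coordinate changes. It makes \<open>coord_vec\<close> a parametrisation of the tangent space,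
  so that any statement on tangent vectors reduces to one on vectors of a single chart.\<close>

lemma transition_cocycle:
  assumes A: "complex_manifold A" and c: "c \<in> A" "m \<in> cdom c" and d: "d \<in> A" "m \<in> cdom d"
    and e: "e \<in> A" "m \<in> cdom e"
  shows "frechet_derivative (cmap e \<circ> cinv d) (at (cmap d m))
      (frechet_derivative (cmap d \<circ> cinv c) (at (cmap c m)) h) =
    frechet_derivative (cmap e \<circ> cinv c) (at (cmap c m)) h"
proof -
  have 1: "((cmap d \<circ> cinv c) has_derivative
      frechet_derivative (cmap d \<circ> cinv c) (at (cmap c m))) (at (cmap c m))"
    by (rule transition_has_derivative[OF A c(1) d(1) c(2) d(2)])
  have 2: "((cmap e \<circ> cinv d) has_derivative
      frechet_derivative (cmap e \<circ> cinv d) (at (cmap d m))) (at ((cmap d \<circ> cinv c) (cmap c m)))"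
    using transition_has_derivative[OF A d(1) e(1) d(2) e(2)] cinv_cmap[OF A c] by simp
  have "((cmap e \<circ> cinv d) \<circ> (cmap d \<circ> cinv c) has_derivative
      frechet_derivative (cmap e \<circ> cinv d) (at (cmap d m)) \<circ>
      frechet_derivative (cmap d \<circ> cinv c) (at (cmap c m))) (at (cmap c m))"
    by (rule diff_chain_at[OF 1 2])
  then have "((cmap e \<circ> cinv c) has_derivative
      frechet_derivative (cmap e \<circ> cinv d) (at (cmap d m)) \<circ>
      frechet_derivative (cmap d \<circ> cinv c) (at (cmap c m))) (at (cmap c m))"
    by (rule has_derivative_transform_within_open[OF _ open_overlap[OF A c(1) d(1)]])
      (use c d in \<open>auto simp: cinv_cmap[OF A]\<close>)
  from frechet_derivative_at[OF this] show ?thesis by (metis comp_apply)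
qed

lemma transition_self:
  assumes A: "complex_manifold A" and c: "c \<in> A" "m \<in> cdom c"
  shows "frechet_derivative (cmap c \<circ> cinv c) (at (cmap c m)) h = h"
proof -
  have "((cmap c \<circ> cinv c) has_derivative (\<lambda>h. h)) (at (cmap c m))"
    by (rule has_derivative_transform_within_open[OF has_derivative_ident open_chart_image[OF A c(1)]])
      (use c in \<open>auto simp: cinv_cmap[OF A]\<close>)
  from frechet_derivative_at[OF this] show ?thesis by metis
qed

lemma coord_vec_chart [simp]:
  assumes "complex_manifold A" "c \<in> A" "m \<in> cdom c"
  shows "coord_vec A c m h c = h"
  using assms transition_self by (simp add: coord_vec_def)

lemma coord_vec_tangent:
  assumes A: "complex_manifold A" and c: "c \<in> A" "m \<in> cdom c"
  shows "coord_vec A c m h \<in> tangent_space A m"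
  unfolding tangent_space_def coord_vec_def
  using transition_cocycle[OF A c] by auto

lemma coord_vec_of_tangent:
  assumes c: "c \<in> A" "m \<in> cdom c" and v: "v \<in> tangent_space A m"
  shows "coord_vec A c m (v c) = v"
proof
  fix d
  show "coord_vec A c m (v c) d = v d"
  proof (cases "d \<in> A \<and> m \<in> cdom d")
    case True
    then have "v d = frechet_derivative (cmap d \<circ> cinv c) (at (cmap c m)) (v c)"
      using v c unfolding tangent_space_def by blast
    then show ?thesis using True by (simp add: coord_vec_def)
  next
    case False
    then have "v d = 0" using v unfolding tangent_space_def by blast
    then show ?thesis using False by (auto simp: coord_vec_def)
  qed
qed

lemma coord_vec_linear:
  assumes A: "complex_manifold A" and c: "c \<in> A" "m \<in> cdom c"
  shows "coord_vec A c m (a *\<^sub>R h + b *\<^sub>R k) = (\<lambda>d. a *\<^sub>R coord_vec A c m h d + b *\<^sub>R coord_vec A c m k d)"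
proof
  fix d
  show "coord_vec A c m (a *\<^sub>R h + b *\<^sub>R k) d = a *\<^sub>R coord_vec A c m h d + b *\<^sub>R coord_vec A c m k d"
  proof (cases "d \<in> A \<and> m \<in> cdom d")
    case True
    then have "linear (frechet_derivative (cmap d \<circ> cinv c) (at (cmap c m)))"
      using transition_has_derivative[OF A c(1) _ c(2)] has_derivative_linear by blast
    then show ?thesis using True by (simp add: coord_vec_def linear_add linear_scale)
  qed (auto simp: coord_vec_def)
qed

lemma cstruct_coord_vec:
  assumes A: "complex_manifold A" and c: "c \<in> A" "m \<in> cdom c"
  shows "cstruct (coord_vec A c m h) = coord_vec A c m (\<i> *s h)"
  using transition_complex_linear[OF A c(1) _ c(2)]
  by (auto simp: cstruct_def coord_vec_def fun_eq_iff)

lemma carrier_ofE: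
  assumes "m \<in> carrier_of A"
  obtains c where "c \<in> A" "m \<in> cdom c"
  using assms by (auto simp: carrier_of_def)

lemma tangent_space_linear:
  assumes A: "complex_manifold A" "m \<in> carrier_of A"
    and u: "u \<in> tangent_space A m" and v: "v \<in> tangent_space A m"
  shows "(\<lambda>c. a *\<^sub>R u c + b *\<^sub>R v c) \<in> tangent_space A m"
proof -
  obtain c where c: "c \<in> A" "m \<in> cdom c" using A(2) by (rule carrier_ofE)
  show ?thesis
    using coord_vec_linear[OF A(1) c, of a "u c" b "v c"] coord_vec_tangent[OF A(1) c]
      coord_vec_of_tangent[OF c u] coord_vec_of_tangent[OF c v] by metis
qed

lemma cstruct_tangent:
  assumes A: "complex_manifold A" "m \<in> carrier_of A" and u: "u \<in> tangent_space A m"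
  shows "cstruct u \<in> tangent_space A m"
proof -
  obtain c where c: "c \<in> A" "m \<in> cdom c" using A(2) by (rule carrier_ofE)
  show ?thesis
    using cstruct_coord_vec[OF A(1) c, of "u c"] coord_vec_tangent[OF A(1) c]
      coord_vec_of_tangent[OF c u] by metis
qed

lemma linear_at_coord_vec:
  assumes A: "complex_manifold A" and c: "c \<in> A" "m \<in> cdom c" and f: "linear_at A m f"
  shows "linear (\<lambda>h. f (coord_vec A c m h))"
proof -
  have *: "f (coord_vec A c m (a *\<^sub>R h + b *\<^sub>R k)) =
      a * f (coord_vec A c m h) + b * f (coord_vec A c m k)" for a b h k
    unfolding coord_vec_linear[OF A c]
    using f coord_vec_tangent[OF A c] unfolding linear_at_def by blast
  show ?thesis
    using *[of 1 _ 1] *[of _ _ 0] by (intro linearI) simp_all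
qed

text \<open>A tangent vector is determined by a single coordinate vector, so the derivative of a smooth
  map can be read off in any one chart.\<close>

lemma dir_deriv_coord_vec:
  assumes A: "complex_manifold A" and f: "smooth_into A S f" "open S" "x \<in> S"
    and c: "c \<in> A" "f x \<in> cdom c"
  shows "dir_deriv A f x h = coord_vec A c (f x) (frechet_derivative (\<lambda>x. cmap c (f x)) (at x) h)"
proof
  fix d
  show "dir_deriv A f x h d = coord_vec A c (f x) (frechet_derivative (\<lambda>x. cmap c (f x)) (at x) h) d"
  proof (cases "d \<in> A \<and> f x \<in> cdom d")
    case True
    let ?U = "{x \<in> S. f x \<in> cdom c}"
    have 1: "((\<lambda>x. cmap c (f x)) has_derivative frechet_derivative (\<lambda>x. cmap c (f x)) (at x)) (at x)"
      using smooth_on_has_derivative[OF smooth_into_smooth[OF f(1) c(1)]] f c by simp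
    have "((cmap d \<circ> cinv c) \<circ> (\<lambda>x. cmap c (f x)) has_derivative
        frechet_derivative (cmap d \<circ> cinv c) (at (cmap c (f x))) \<circ>
        frechet_derivative (\<lambda>x. cmap c (f x)) (at x)) (at x)"
      using diff_chain_at[OF 1] transition_has_derivative[OF A c(1) _ c(2)] True by blast
    then have "((cmap d \<circ> f) has_derivative
        frechet_derivative (cmap d \<circ> cinv c) (at (cmap c (f x))) \<circ>
        frechet_derivative (\<lambda>x. cmap c (f x)) (at x)) (at x)"
      by (rule has_derivative_transform_within_open[OF _ smooth_into_open[OF f(1,2) c(1)]])
        (use f c in \<open>auto simp: cinv_cmap[OF A c(1)]\<close>)
    from frechet_derivative_at[OF this] show ?thesis
      using True by (metis (no_types, lifting) comp_apply coord_vec_def dir_deriv_def)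
  qed (auto simp: dir_deriv_def coord_vec_def)
qed

lemma dir_deriv_tangent:
  assumes "complex_manifold A" "smooth_into A S f" "open S" "x \<in> S"
  shows "dir_deriv A f x h \<in> tangent_space A (f x)"
  using smooth_into_carrier[OF assms(2,4)] dir_deriv_coord_vec[OF assms] coord_vec_tangent[OF assms(1)]
  by metis

text \<open>A shift does not change the set of linear maps from which \<open>frechet_derivative\<close> chooses.\<close>

lemma dir_deriv_shift:
  fixes f :: "'a::euclidean_space \<Rightarrow> 'm" and A :: "('m, 'n::finite) chart set"
  shows "dir_deriv A (\<lambda>x. f (x + a)) x h = dir_deriv A f (x + a) h"
proof -
  have "(F has_derivative D) (at (x + a)) \<longleftrightarrow> ((\<lambda>x. F (x + a)) has_derivative D) (at x)"
    for F :: "'a \<Rightarrow> complex^'n" and D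
    unfolding has_derivative_at by (simp add: ac_simps)
  then have "frechet_derivative F (at (x + a)) = frechet_derivative (\<lambda>x. F (x + a)) (at x)"
    for F :: "'a \<Rightarrow> complex^'n"
    by (simp add: frechet_derivative_def)
  then show ?thesis by (auto simp: dir_deriv_def comp_def)
qed

section \<open>Smooth bilinear fields and their pullbacks\<close>

definition smooth_bilinear_field ::
  "('m, 'n::finite) chart set \<Rightarrow> ('m, 'n) bilinear_field \<Rightarrow> bool" where
  "smooth_bilinear_field A b \<longleftrightarrow> (\<forall>c\<in>A.
     (\<forall>x\<in>cmap c ` cdom c. bilinear (\<lambda>h k. local_coeff A b c h k x)) \<and>
     (\<forall>h k. smooth_on (cmap c ` cdom c) (local_coeff A b c h k)))"

lemma local_coeff_cmap:
  assumes "complex_manifold A" "c \<in> A" "m \<in> cdom c"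
  shows "local_coeff A b c h k (cmap c m) = b m (coord_vec A c m h) (coord_vec A c m k)"
  using assms by (simp add: local_coeff_def cinv_cmap)

lemma smooth_on_pairing_chart:
  assumes A: "complex_manifold A" and b: "smooth_bilinear_field A b"
    and f: "smooth_into A S f" "open S" and c: "c \<in> A"
    and u: "smooth_on {x \<in> S. f x \<in> cdom c} u" and v: "smooth_on {x \<in> S. f x \<in> cdom c} v"
  shows "smooth_on {x \<in> S. f x \<in> cdom c}
    (\<lambda>x. b (f x) (coord_vec A c (f x) (u x)) (coord_vec A c (f x) (v x)))" (is "smooth_on ?U _")
proof -
  have o: "open ?U" by (rule smooth_into_open[OF f c])
  have "smooth_on ?U (\<lambda>x. local_coeff A b c (u x) (v x) (cmap c (f x)))"
  proof (rule smooth_on_bilinear_family[where \<beta>="\<lambda>h k x. local_coeff A b c h k (cmap c (f x))", OF o _ _ u v])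
    show "bilinear (\<lambda>h k. local_coeff A b c h k (cmap c (f x)))" if "x \<in> ?U" for x
      using b c that unfolding smooth_bilinear_field_def by blast
    show "smooth_on ?U (\<lambda>x. local_coeff A b c h k (cmap c (f x)))" for h k
      by (rule smooth_on_compose[OF o open_chart_image[OF A c] _ smooth_into_smooth[OF f(1) c]])
        (use b c in \<open>auto simp: smooth_bilinear_field_def\<close>)
  qed
  then show ?thesis
    by (rule smooth_on_cong[OF o, THEN iffD1, rotated]) (use local_coeff_cmap[OF A c] in auto)
qed

text \<open>Sections of the pullback of the tangent bundle along \<open>f\<close>.\<close>

definition smooth_field_along ::
  "('m, 'n::finite) chart set \<Rightarrow> 'a::euclidean_space set \<Rightarrow> ('a \<Rightarrow> 'm) \<Rightarrow> ('a \<Rightarrow> ('m, 'n) tvec) \<Rightarrow> bool" where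
  "smooth_field_along A S f u \<longleftrightarrow> (\<forall>x\<in>S. u x \<in> tangent_space A (f x)) \<and>
     (\<forall>c\<in>A. smooth_on {x \<in> S. f x \<in> cdom c} (\<lambda>x. u x c))"

lemma smooth_on_pairing:
  assumes A: "complex_manifold A" and b: "smooth_bilinear_field A b"
    and f: "smooth_into A S f" "open S"
    and u: "smooth_field_along A S f u" and v: "smooth_field_along A S f v"
  shows "smooth_on S (\<lambda>x. b (f x) (u x) (v x))"
proof (rule smooth_on_local)
  fix x assume x: "x \<in> S"
  obtain c where c: "c \<in> A" "f x \<in> cdom c" using smooth_into_carrier[OF f(1) x] .
  let ?U = "{x \<in> S. f x \<in> cdom c}"
  have o: "open ?U" by (rule smooth_into_open[OF f c(1)])
  have "smooth_on ?U (\<lambda>x. b (f x) (coord_vec A c (f x) (u x c)) (coord_vec A c (f x) (v x c)))"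
    by (rule smooth_on_pairing_chart[OF A b f c(1)])
      (use u v c in \<open>auto simp: smooth_field_along_def\<close>)
  then have "smooth_on ?U (\<lambda>x. b (f x) (u x) (v x))"
    by (rule smooth_on_cong[OF o, THEN iffD1, rotated])
      (use u v c in \<open>auto simp: smooth_field_along_def coord_vec_of_tangent\<close>)
  then show "\<exists>U. open U \<and> x \<in> U \<and> smooth_on U (\<lambda>x. b (f x) (u x) (v x))"
    using o x c by blast
qed

lemma smooth_field_along_dir_deriv:
  assumes A: "complex_manifold A" and f: "smooth_into A S f" "open S"
  shows "smooth_field_along A S f (\<lambda>x. dir_deriv A f x h)"
  unfolding smooth_field_along_def
proof (intro conjI ballI)
  fix c assume c: "c \<in> A"
  have "smooth_on {x \<in> S. f x \<in> cdom c} (\<lambda>x. frechet_derivative (\<lambda>x. cmap c (f x)) (at x) h)"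
    by (rule smooth_on_frechet_derivative[OF smooth_into_smooth[OF f(1) c]])
  then show "smooth_on {x \<in> S. f x \<in> cdom c} (\<lambda>x. dir_deriv A f x h c)"
    by (rule smooth_on_cong[OF smooth_into_open[OF f c], THEN iffD1, rotated])
      (use c in \<open>auto simp: dir_deriv_def comp_def\<close>)
qed (rule dir_deriv_tangent[OF A f])

text \<open>The coordinate expression of \<open>d (f\<^sup>* w) = f\<^sup>* (d w)\<close>: the terms containing second derivatives
  of \<open>f\<close> cancel in pairs.\<close>

lemma pullback_closed:
  assumes A: "complex_manifold A" and w: "smooth_bilinear_field A w" "closed_two_form A w"
    and anti: "\<And>m u v. m \<in> carrier_of A \<Longrightarrow> u \<in> tangent_space A m \<Longrightarrow> v \<in> tangent_space A m \<Longrightarrow>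
      w m u v = - w m v u"
    and f: "smooth_into A S f" "open S" "x \<in> S"
    and P: "\<And>h k x. P h k x = w (f x) (dir_deriv A f x h) (dir_deriv A f x k)"
  shows "frechet_derivative (P k l) (at x) h - frechet_derivative (P h l) (at x) k
    + frechet_derivative (P h k) (at x) l = 0"
proof -
  obtain c where c: "c \<in> A" "f x \<in> cdom c" using smooth_into_carrier[OF f(1,3)] .
  define U where "U = {x \<in> S. f x \<in> cdom c}"
  define \<phi> where "\<phi> x = cmap c (f x)" for x
  define D where "D h = (\<lambda>x. frechet_derivative \<phi> (at x) h)" for h
  define DD where "DD h = frechet_derivative (D h) (at x)" for h
  define \<omega> where "\<omega> h k = local_coeff A w c h k (\<phi> x)" for h k
  define d\<omega> where "d\<omega> h k = frechet_derivative (local_coeff A w c h k) (at (\<phi> x))" for h k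
  have U: "open U" "x \<in> U" unfolding U_def using smooth_into_open[OF f(1,2) c(1)] f c by auto
  have \<phi>: "smooth_on U \<phi>" unfolding U_def \<phi>_def by (rule smooth_into_smooth[OF f(1) c(1)])
  have \<phi>U: "\<phi> y \<in> cmap c ` cdom c" if "y \<in> U" for y using that by (auto simp: U_def \<phi>_def)
  have bil: "bilinear (\<lambda>h k. local_coeff A w c h k (\<phi> y))" if "y \<in> U" for y
    using w(1) c \<phi>U[OF that] unfolding smooth_bilinear_field_def by blast
  (* The two terms with DD come from differentiating the arguments of w. *)
  have DP: "frechet_derivative (P h k) (at x) l =
      d\<omega> (D h x) (D k x) (D l x) + \<omega> (DD h l) (D k x) + \<omega> (D h x) (DD k l)" for h k l
  proof -
    have Dd: "(D h has_derivative DD h) (at x)" for h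
      unfolding DD_def by (rule smooth_on_has_derivative[OF _ U(2)])
        (simp add: D_def smooth_on_frechet_derivative[OF \<phi>])
    have "((\<lambda>x. local_coeff A w c h k (\<phi> x)) has_derivative (\<lambda>l. d\<omega> h k (D l x))) (at x)" for h k
    proof -
      have "smooth_on (cmap c ` cdom c) (local_coeff A w c h k)"
        using w(1) c unfolding smooth_bilinear_field_def by blast
      from smooth_on_has_derivative[OF this \<phi>U[OF U(2)]]
      show ?thesis
        using has_derivative_compose[OF smooth_on_has_derivative[OF \<phi> U(2)]]
        unfolding d\<omega>_def D_def by blast
    qed
    from bilinear_family_has_derivative[where \<beta>="\<lambda>h k x. local_coeff A w c h k (\<phi> x)",
        OF U bil this Dd[of h] Dd[of k]]
    have "((\<lambda>y. local_coeff A w c (D h y) (D k y) (\<phi> y)) has_derivative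
        (\<lambda>l. d\<omega> (D h x) (D k x) (D l x) + \<omega> (DD h l) (D k x) + \<omega> (D h x) (DD k l))) (at x)"
      unfolding \<omega>_def by blast
    then have "(P h k has_derivative
        (\<lambda>l. d\<omega> (D h x) (D k x) (D l x) + \<omega> (DD h l) (D k x) + \<omega> (D h x) (DD k l))) (at x)"
    proof (rule has_derivative_transform_within_open[OF _ U])
      fix y assume y: "y \<in> U"
      then have y': "y \<in> S" "f y \<in> cdom c" by (auto simp: U_def)
      show "local_coeff A w c (D h y) (D k y) (\<phi> y) = P h k y"
        unfolding P dir_deriv_coord_vec[OF A f(1,2) y'(1) c(1) y'(2)] \<phi>_def
          local_coeff_cmap[OF A c(1) y'(2)] D_def ..
    qed
    from frechet_derivative_at[OF this] show ?thesis by (rule fun_cong[symmetric])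
  qed
  have sym: "DD h k = DD k h" for h k
    unfolding DD_def D_def by (rule second_derivative_symmetric[OF U(1) \<phi> U(2)])
  have anti': "\<omega> h k = - \<omega> k h" for h k
    unfolding \<omega>_def \<phi>_def local_coeff_cmap[OF A c]
    by (rule anti) (use c coord_vec_tangent[OF A c] in \<open>auto simp: carrier_of_def\<close>)
  have "d\<omega> (D k x) (D l x) (D h x) - d\<omega> (D h x) (D l x) (D k x) + d\<omega> (D h x) (D k x) (D l x) = 0"
    using w(2) c \<phi>U[OF U(2)] unfolding closed_two_form_def d\<omega>_def by blast
  then show ?thesis
    unfolding DP sym[of k h] sym[of l h] sym[of l k]
    using anti'[of "DD h k" "D l x"] anti'[of "DD h l" "D k x"] anti'[of "D h x" "DD k l"] by simp
qed

section \<open>The cotangent bundle\<close>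

text \<open>The bundle projection in coordinates.\<close>

definition base_part :: "complex^('n::finite + 'n) \<Rightarrow> complex^'n" where
  "base_part x = (\<chi> j. x $ Inl j)"

lemma bounded_linear_base_part: "bounded_linear base_part"
  unfolding linear_conv_bounded_linear[symmetric]
  by (rule linearI) (simp_all add: base_part_def vec_eq_iff)

lemma base_part_mult: "base_part (z *s x) = z *s base_part x"
  by (simp add: base_part_def vec_eq_iff)

lemma cdom_cotangent_chart:
  "z \<in> cdom (cotangent_chart A c) \<longleftrightarrow> fst z \<in> cdom c \<and> snd z \<in> cotangent_space A (fst z)"
  by (auto simp: cotangent_chart_def split_beta)

lemma cmap_cotangent_chart_Inl: "cmap (cotangent_chart A c) z $ Inl j = cmap c (fst z) $ j"
  by (simp add: cotangent_chart_def split_beta)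

lemma cmap_cotangent_chart_Inr: "cmap (cotangent_chart A c) z $ Inr j =
    complex_of_real (snd z (coord_vec A c (fst z) (axis j 1)))
    - \<i> * complex_of_real (snd z (coord_vec A c (fst z) (axis j \<i>)))"
  by (simp add: cotangent_chart_def split_beta)

lemma base_part_cotangent_chart: "base_part (cmap (cotangent_chart A c) z) = cmap c (fst z)"
  by (simp add: base_part_def vec_eq_iff cmap_cotangent_chart_Inl)

lemma complex_vec_real_expansion:
  fixes h :: "complex^'n"
  shows "h = (\<Sum>j\<in>UNIV. Re (h $ j) *\<^sub>R axis j 1 + Im (h $ j) *\<^sub>R axis j \<i>)"
proof -
  have "(\<Sum>j\<in>UNIV. Re (h $ j) *\<^sub>R axis j 1 + Im (h $ j) *\<^sub>R axis j \<i>) $ k = h $ k" for k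
  proof -
    have "(\<Sum>j\<in>UNIV. Re (h $ j) *\<^sub>R axis j 1 + Im (h $ j) *\<^sub>R axis j \<i>) $ k =
        (\<Sum>j\<in>UNIV. if j = k then Re (h $ k) *\<^sub>R 1 + Im (h $ k) *\<^sub>R \<i> else 0)"
      unfolding sum_component by (rule sum.cong) (auto simp: axis_def)
    also have "\<dots> = h $ k" by (simp add: complex_eq_iff)
    finally show ?thesis .
  qed
  then show ?thesis by (simp add: vec_eq_iff)
qed

text \<open>The fibre coordinates \<open>p\<^sub>j\<close> are those for which a covector acts on \<open>h\<close> as
  \<open>Re (\<Sum>j. p\<^sub>j h\<^sub>j)\<close>.\<close>

lemma covector_coord_vec:
  assumes A: "complex_manifold A" and c: "c \<in> A" "fst z \<in> cdom c"
    and z: "snd z \<in> cotangent_space A (fst z)"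
  shows "snd z (coord_vec A c (fst z) h) =
    Re (\<Sum>j\<in>UNIV. cmap (cotangent_chart A c) z $ Inr j * h $ j)"
proof -
  define f where "f h = snd z (coord_vec A c (fst z) h)" for h
  have lin: "linear f"
    unfolding f_def by (rule linear_at_coord_vec[OF A c]) (use z in \<open>simp add: cotangent_space_def\<close>)
  have "f h = f (\<Sum>j\<in>UNIV. Re (h $ j) *\<^sub>R axis j 1 + Im (h $ j) *\<^sub>R axis j \<i>)"
    by (simp only: complex_vec_real_expansion[symmetric])
  also have "\<dots> = (\<Sum>j\<in>UNIV. Re (h $ j) * f (axis j 1) + Im (h $ j) * f (axis j \<i>))"
    using lin by (simp add: linear_sum linear_add linear_scale)
  also have "\<dots> = Re (\<Sum>j\<in>UNIV. cmap (cotangent_chart A c) z $ Inr j * h $ j)"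
    by (simp add: cmap_cotangent_chart_Inr f_def[symmetric] mult.commute)
  finally show ?thesis by (simp add: f_def)
qed

text \<open>The fibre of the cotangent bundle over a chart is the full dual space, which is what makes the image
  of a cotangent chart open.\<close>

lemma covector_with_coords:
  assumes A: "complex_manifold A" and c: "c \<in> A" "m \<in> cdom c" and f: "linear f"
  shows "\<exists>p\<in>cotangent_space A m. \<forall>h. p (coord_vec A c m h) = f h"
proof (intro bexI allI)
  let ?p = "\<lambda>v. if v \<in> tangent_space A m then f (v c) else 0"
  have m: "m \<in> carrier_of A" using c by (auto simp: carrier_of_def)
  show "?p (coord_vec A c m h) = f h" for h
    using coord_vec_tangent[OF A c] A c by simp
  show "?p \<in> cotangent_space A m"
    unfolding cotangent_space_def linear_at_def
    using tangent_space_linear[OF A m] f by (simp add: linear_add linear_scale)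
qed

lemma cotangent_chart_image:
  fixes A :: "('m, 'n::finite) chart set"
  assumes A: "complex_manifold A" and c: "c \<in> A"
  shows "cmap (cotangent_chart A c) ` cdom (cotangent_chart A c) = base_part -` (cmap c ` cdom c)"
proof (intro equalityI subsetI)
  fix x assume "x \<in> cmap (cotangent_chart A c) ` cdom (cotangent_chart A c)"
  then show "x \<in> base_part -` (cmap c ` cdom c)"
    by (auto simp: base_part_cotangent_chart cdom_cotangent_chart)
next
  fix x assume "x \<in> base_part -` (cmap c ` cdom c)"
  then obtain m where m: "m \<in> cdom c" "base_part x = cmap c m" by auto
  (* The functional with the prescribed fibre coordinates. *)
  define f where "f h = Re (\<Sum>j\<in>UNIV. x $ Inr j * h $ j)" for h :: "complex^'n"
  have "linear f"
    unfolding f_def by (rule linearI) (simp_all add: algebra_simps sum.distrib sum_distrib_left sum_subtractf)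
  then obtain p where p: "p \<in> cotangent_space A m" "\<And>h. p (coord_vec A c m h) = f h"
    using covector_with_coords[OF A c m(1)] by blast
  have f_axis: "f (axis j z) = Re (x $ Inr j * z)" for j z
  proof -
    have "(\<Sum>k\<in>UNIV. x $ Inr k * axis j z $ k) = (\<Sum>k\<in>UNIV. if k = j then x $ Inr j * z else 0)"
      by (rule sum.cong) (auto simp: axis_def)
    then show ?thesis by (simp add: f_def)
  qed
  have "cmap (cotangent_chart A c) (m, p) $ k = x $ k" for k
  proof (cases k)
    case (Inl j)
    then show ?thesis
      using m(2) by (simp add: cmap_cotangent_chart_Inl base_part_def vec_eq_iff)
  next
    case (Inr j)
    then show ?thesis
      by (simp add: cmap_cotangent_chart_Inr p(2) f_axis complex_eq_iff)
  qed
  then have "x = cmap (cotangent_chart A c) (m, p)" by (simp add: vec_eq_iff)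
  then show "x \<in> cmap (cotangent_chart A c) ` cdom (cotangent_chart A c)"
    using m p by (auto simp: cdom_cotangent_chart)
qed

lemma open_cotangent_chart_image:
  assumes "complex_manifold A" "c \<in> A"
  shows "open (cmap (cotangent_chart A c) ` cdom (cotangent_chart A c))"
  unfolding cotangent_chart_image[OF assms]
  by (intro open_vimage open_chart_image[OF assms] linear_continuous_on bounded_linear_base_part)

lemma smooth_into_cotangent_covector:
  assumes "smooth_into (cotangent_atlas A) S Z" "x \<in> S"
  shows "snd (Z x) \<in> cotangent_space A (fst (Z x))"
proof -
  obtain C where "C \<in> cotangent_atlas A" "Z x \<in> cdom C" using smooth_into_carrier[OF assms] .
  then show ?thesis by (auto simp: cotangent_atlas_def cdom_cotangent_chart)
qed

lemma smooth_into_cotangent_dom: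
  assumes "smooth_into (cotangent_atlas A) S Z"
  shows "{x \<in> S. Z x \<in> cdom (cotangent_chart A c)} = {x \<in> S. fst (Z x) \<in> cdom c}"
  using smooth_into_cotangent_covector[OF assms] by (auto simp: cdom_cotangent_chart)

lemma smooth_into_cotangent_coords:
  assumes Z: "smooth_into (cotangent_atlas A) S Z" and c: "c \<in> A"
  shows "smooth_on {x \<in> S. fst (Z x) \<in> cdom c} (\<lambda>x. cmap (cotangent_chart A c) (Z x))"
  using smooth_into_smooth[OF Z, of "cotangent_chart A c"] c smooth_into_cotangent_dom[OF Z]
  by (simp add: cotangent_atlas_def)

lemma smooth_into_cotangent_open:
  assumes Z: "smooth_into (cotangent_atlas A) S Z" "open S" and c: "c \<in> A"
  shows "open {x \<in> S. fst (Z x) \<in> cdom c}"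
  using smooth_into_open[OF Z, of "cotangent_chart A c"] c smooth_into_cotangent_dom[OF Z(1)]
  by (simp add: cotangent_atlas_def)

lemma smooth_into_base:
  assumes Z: "smooth_into (cotangent_atlas A) S Z" "open S"
  shows "smooth_into A S (\<lambda>x. fst (Z x))"
proof (rule smooth_intoI[OF Z(2)])
  show "fst (Z x) \<in> carrier_of A" if x: "x \<in> S" for x
  proof -
    obtain C where "C \<in> cotangent_atlas A" "Z x \<in> cdom C" using smooth_into_carrier[OF Z(1) x] .
    then obtain c where "c \<in> A" "Z x \<in> cdom (cotangent_chart A c)" unfolding cotangent_atlas_def by blast
    then show ?thesis unfolding carrier_of_def cdom_cotangent_chart by blast
  qed
  fix c assume c: "c \<in> A"
  show o: "open {x \<in> S. fst (Z x) \<in> cdom c}" by (rule smooth_into_cotangent_open[OF Z c])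
  show "smooth_on {x \<in> S. fst (Z x) \<in> cdom c} (\<lambda>x. cmap c (fst (Z x)))"
    using smooth_on_bounded_linear[OF o smooth_into_cotangent_coords[OF Z(1) c] bounded_linear_base_part]
    by (simp add: base_part_cotangent_chart)
qed

lemma smooth_into_covector_coeff:
  fixes A :: "('m, 'n::finite) chart set"
  assumes A: "complex_manifold A" and Z: "smooth_into (cotangent_atlas A) S Z" "open S" and c: "c \<in> A"
  shows "smooth_on {x \<in> S. fst (Z x) \<in> cdom c} (\<lambda>x. snd (Z x) (coord_vec A c (fst (Z x)) h))"
proof -
  have "bounded_linear (\<lambda>y. Re (\<Sum>j\<in>UNIV. y $ Inr j * h $ j))" for h :: "complex^'n"
    unfolding linear_conv_bounded_linear[symmetric]
    by (rule linearI) (simp_all add: algebra_simps sum.distrib sum_distrib_left sum_subtractf)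
  from smooth_on_bounded_linear[OF smooth_into_cotangent_open[OF Z c]
      smooth_into_cotangent_coords[OF Z(1) c] this]
  show ?thesis
    by (rule smooth_on_cong[OF smooth_into_cotangent_open[OF Z c], THEN iffD1, rotated])
      (use smooth_into_cotangent_covector[OF Z(1)] covector_coord_vec[OF A c] in auto)
qed

text \<open>Reduces smoothness of the coordinates on the cotangent bundle to that of the components.\<close>

lemma smooth_on_vec:
  fixes f :: "'a::euclidean_space \<Rightarrow> complex^'k"
  assumes "open S" "\<And>i. smooth_on S (\<lambda>x. f x $ i)"
  shows "smooth_on S f"
proof -
  have "bounded_linear (axis i :: complex \<Rightarrow> complex^'k)" for i
    unfolding linear_conv_bounded_linear[symmetric]
    by (rule linearI) (simp_all add: axis_def vec_eq_iff)
  then have "smooth_on S (\<lambda>x. \<Sum>i\<in>UNIV. axis i (f x $ i))"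
    by (intro smooth_on_sum smooth_on_bounded_linear[where L="axis _"] assms)
  moreover have "(\<Sum>i\<in>UNIV. axis i (y $ i)) = y" for y :: "complex^'k"
  proof -
    have "(\<Sum>i\<in>UNIV. axis i (y $ i)) $ k = (\<Sum>i\<in>UNIV. if i = k then y $ k else 0)" for k
      unfolding sum_component by (rule sum.cong) (auto simp: axis_def)
    then show ?thesis by (simp add: vec_eq_iff)
  qed
  ultimately show ?thesis by simp
qed

text \<open>The fibre coordinates of \<open>p\<close> are built from its values on the coordinate vectors of the base.\<close>

lemma smooth_into_cotangentI:
  assumes q: "smooth_into A S q" "open S" and p: "\<And>x. x \<in> S \<Longrightarrow> p x \<in> cotangent_space A (q x)"
    and sm: "\<And>c h. c \<in> A \<Longrightarrow> smooth_on {x \<in> S. q x \<in> cdom c} (\<lambda>x. p x (coord_vec A c (q x) h))"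
  shows "smooth_into (cotangent_atlas A) S (\<lambda>x. (q x, p x))"
proof (rule smooth_intoI[OF q(2)])
  show "(q x, p x) \<in> carrier_of (cotangent_atlas A)" if x: "x \<in> S" for x
  proof -
    obtain c where "c \<in> A" "q x \<in> cdom c" using smooth_into_carrier[OF q(1) x] .
    then show ?thesis
      using p[OF x] by (auto simp: carrier_of_def cotangent_atlas_def cdom_cotangent_chart)
  qed
  fix C assume "C \<in> cotangent_atlas A"
  then obtain c where c: "c \<in> A" "C = cotangent_chart A c" by (auto simp: cotangent_atlas_def)
  have dom: "{x \<in> S. (q x, p x) \<in> cdom C} = {x \<in> S. q x \<in> cdom c}"
    using p by (auto simp: c(2) cdom_cotangent_chart)
  show "open {x \<in> S. (q x, p x) \<in> cdom C}" unfolding dom by (rule smooth_into_open[OF q c(1)])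
  note o = smooth_into_open[OF q c(1)]
  show "smooth_on {x \<in> S. (q x, p x) \<in> cdom C} (\<lambda>x. cmap C (q x, p x))"
    unfolding dom
  proof (rule smooth_on_vec[OF o])
    fix k
    show "smooth_on {x \<in> S. q x \<in> cdom c} (\<lambda>x. cmap C (q x, p x) $ k)"
    proof (cases k)
      case (Inl j)
      then show ?thesis
        using smooth_on_bounded_linear[OF o smooth_into_smooth[OF q(1) c(1)] bounded_linear_vec_nth]
        by (simp add: c(2) cmap_cotangent_chart_Inl)
    next
      case (Inr j)
      have "bounded_linear (\<lambda>r. \<i> * complex_of_real r)"
        by (rule bounded_linear_compose[OF bounded_linear_mult_right bounded_linear_of_real])
      then show ?thesis
        using Inr by (auto simp: c(2) cmap_cotangent_chart_Inr
            intro!: smooth_on_diff o smooth_on_bounded_linear[OF o sm[OF c(1)]] bounded_linear_of_real)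
    qed
  qed
qed

text \<open>Projecting along \<open>T\<^sup>*Q \<rightarrow> Q\<close> is linear in adapted coordinates, whichever chart the
  differential is computed in.\<close>

lemma differential_bundle_projection:
  assumes A: "complex_manifold A" and z: "z \<in> carrier_of (cotangent_atlas A)"
  shows "\<exists>c\<in>A. fst z \<in> cdom c \<and> (\<forall>v. differential (cotangent_atlas A) A fst z v =
    coord_vec A c (fst z) (base_part (v (cotangent_chart A c))))"
proof -
  define C where "C = (SOME C. C \<in> cotangent_atlas A \<and> z \<in> cdom C)"
  have "C \<in> cotangent_atlas A \<and> z \<in> cdom C"
    unfolding C_def by (rule someI_ex) (use z in \<open>auto simp: carrier_of_def\<close>)
  then obtain c where c: "c \<in> A" "C = cotangent_chart A c" and zC: "z \<in> cdom C"
    by (auto simp: cotangent_atlas_def)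
  have m: "fst z \<in> cdom c" using zC by (simp add: c(2) cdom_cotangent_chart)
  have D: "frechet_derivative (cmap d \<circ> fst \<circ> cinv C) (at (cmap C z)) h =
      frechet_derivative (cmap d \<circ> cinv c) (at (cmap c (fst z))) (base_part h)"
    if d: "d \<in> A" "fst z \<in> cdom d" for d h
  proof -
    have 1: "(base_part has_derivative base_part) (at (cmap C z))"
      by (rule bounded_linear_imp_has_derivative[OF bounded_linear_base_part])
    have "((cmap d \<circ> cinv c) \<circ> base_part has_derivative
        frechet_derivative (cmap d \<circ> cinv c) (at (cmap c (fst z))) \<circ> base_part) (at (cmap C z))"
      by (rule diff_chain_at[OF 1])
        (use transition_has_derivative[OF A c(1) d(1) m d(2)] in
          \<open>simp add: c(2) base_part_cotangent_chart\<close>)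
    then have "((cmap d \<circ> fst \<circ> cinv C) has_derivative
        frechet_derivative (cmap d \<circ> cinv c) (at (cmap c (fst z))) \<circ> base_part) (at (cmap C z))"
    proof (rule has_derivative_transform_within_open[OF _ open_cotangent_chart_image[OF A c(1)]])
      show "cmap C z \<in> cmap (cotangent_chart A c) ` cdom (cotangent_chart A c)"
        using zC by (simp add: c(2))
      fix y assume "y \<in> cmap (cotangent_chart A c) ` cdom (cotangent_chart A c)"
      then have y: "cinv C y \<in> cdom C" "cmap C (cinv C y) = y"
        unfolding c(2) by (auto intro: inv_into_into f_inv_into_f)
      have "cinv c (base_part y) = fst (cinv C y)"
        using y base_part_cotangent_chart[of A c "cinv C y"] cinv_cmap[OF A c(1), of "fst (cinv C y)"]
        by (simp add: c(2) cdom_cotangent_chart)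
      then show "((cmap d \<circ> cinv c) \<circ> base_part) y = (cmap d \<circ> fst \<circ> cinv C) y" by simp
    qed
    from frechet_derivative_at[OF this] show ?thesis by (metis comp_apply)
  qed
  have "differential (cotangent_atlas A) A fst z v = coord_vec A c (fst z) (base_part (v C))" for v
    unfolding differential_def C_def[symmetric] Let_def coord_vec_def by (rule ext) (simp add: D)
  then show ?thesis using c m by blast
qed

text \<open>The two integrands of the action: \<open>\<theta>\<^sub>1 (\<partial>Z) = p (\<partial>q)\<close> and \<open>\<theta>\<^sub>2 (\<partial>Z) = - p (\<i> \<partial>q)\<close>. The second holds since
  the bundle projection is holomorphic.\<close>

lemma liouville_dir_deriv:
  fixes A :: "('m, 'n::finite) chart set" and Z :: "'a::euclidean_space \<Rightarrow> ('m, 'n) cotangent" and h :: 'a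
  assumes A: "complex_manifold A" and Z: "smooth_into (cotangent_atlas A) S Z" "open S" "x \<in> S"
  defines "v \<equiv> dir_deriv (cotangent_atlas A) Z x h"
  defines "u \<equiv> dir_deriv A (\<lambda>x. fst (Z x)) x h"
  shows "liouville A (Z x) v = snd (Z x) u"
    and "liouville A (Z x) (cstruct v) = snd (Z x) (cstruct u)"
proof -
  have zc: "Z x \<in> carrier_of (cotangent_atlas A)"
  proof -
    obtain C where "C \<in> cotangent_atlas A" "Z x \<in> cdom C" using smooth_into_carrier[OF Z(1,3)] .
    then show ?thesis by (auto simp: carrier_of_def)
  qed
  obtain c where c: "c \<in> A" "fst (Z x) \<in> cdom c"
    and D: "\<And>v. differential (cotangent_atlas A) A fst (Z x) v =
      coord_vec A c (fst (Z x)) (base_part (v (cotangent_chart A c)))"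
    using differential_bundle_projection[OF A zc] by blast
  let ?C = "cotangent_chart A c"
  have C: "?C \<in> cotangent_atlas A" "Z x \<in> cdom ?C"
    using c smooth_into_cotangent_covector[OF Z(1,3)] by (auto simp: cotangent_atlas_def cdom_cotangent_chart)
  have d: "((\<lambda>x. cmap ?C (Z x)) has_derivative frechet_derivative (\<lambda>x. cmap ?C (Z x)) (at x)) (at x)"
    using smooth_on_has_derivative[OF smooth_into_cotangent_coords[OF Z(1) c(1)]] Z c by simp
  have "base_part (frechet_derivative (\<lambda>x. cmap ?C (Z x)) (at x) h) =
      frechet_derivative (\<lambda>x. cmap c (fst (Z x))) (at x) h"
    using frechet_derivative_at[OF bounded_linear.has_derivative[OF bounded_linear_base_part d]]
    unfolding base_part_cotangent_chart by (rule fun_cong)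
  moreover have "v ?C = frechet_derivative (\<lambda>x. cmap ?C (Z x)) (at x) h"
    unfolding v_def dir_deriv_def using C by (simp add: comp_def)
  ultimately have u: "coord_vec A c (fst (Z x)) (base_part (v ?C)) = u"
    unfolding u_def dir_deriv_coord_vec[OF A smooth_into_base[OF Z(1,2)] Z(2,3) c] by simp
  show "liouville A (Z x) v = snd (Z x) u"
    unfolding liouville_def D u ..
  have "coord_vec A c (fst (Z x)) (base_part (cstruct v ?C)) = cstruct u"
    unfolding u[symmetric] cstruct_coord_vec[OF A c] by (simp add: cstruct_def base_part_mult)
  then show "liouville A (Z x) (cstruct v) = snd (Z x) (cstruct u)"
    unfolding liouville_def D by simp
qed

lemma smooth_on_covector_field:
  assumes A: "complex_manifold A" and Z: "smooth_into (cotangent_atlas A) S Z" "open S"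
    and u: "smooth_field_along A S (\<lambda>x. fst (Z x)) u"
  shows "smooth_on S (\<lambda>x. snd (Z x) (u x))"
proof (rule smooth_on_local)
  fix x assume x: "x \<in> S"
  obtain c where c: "c \<in> A" "fst (Z x) \<in> cdom c"
    using smooth_into_carrier[OF smooth_into_base[OF Z] x] .
  let ?U = "{x \<in> S. fst (Z x) \<in> cdom c}"
  have o: "open ?U" by (rule smooth_into_cotangent_open[OF Z c(1)])
  have "smooth_on ?U (\<lambda>x. \<Sum>E\<in>Basis. (u x c \<bullet> E) * snd (Z x) (coord_vec A c (fst (Z x)) E))"
    by (intro smooth_on_sum smooth_on_mult o smooth_into_covector_coeff[OF A Z c(1)]
        smooth_on_bounded_linear[OF o _ bounded_linear_inner_left])
      (use u c in \<open>auto simp: smooth_field_along_def\<close>)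
  then have "smooth_on ?U (\<lambda>x. snd (Z x) (u x))"
  proof (rule smooth_on_cong[OF o, THEN iffD1, rotated])
    fix y assume y: "y \<in> ?U"
    define f where "f h = snd (Z y) (coord_vec A c (fst (Z y)) h)" for h
    have "linear f"
      unfolding f_def using y smooth_into_cotangent_covector[OF Z(1)]
      by (intro linear_at_coord_vec[OF A c(1)]) (auto simp: cotangent_space_def)
    then have "(\<Sum>E\<in>Basis. (u y c \<bullet> E) * f E) = f (\<Sum>E\<in>Basis. (u y c \<bullet> E) *\<^sub>R E)"
      by (simp add: linear_sum linear_scale)
    also have "\<dots> = snd (Z y) (u y)"
      using u y c by (simp add: f_def euclidean_representation smooth_field_along_def coord_vec_of_tangent)
    finally show "(\<Sum>E\<in>Basis. (u y c \<bullet> E) * snd (Z y) (coord_vec A c (fst (Z y)) E)) = snd (Z y) (u y)"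
      unfolding f_def .
  qed
  then show "\<exists>U. open U \<and> x \<in> U \<and> smooth_on U (\<lambda>x. snd (Z x) (u x))"
    using o x c by blast
qed

section \<open>Kaehler metrics\<close>

locale kaehler =
  fixes A :: "('m, 'n::finite) chart set" and g :: "('m, 'n) bilinear_field"
  assumes kaehler: "kaehler_manifold A g"
begin

abbreviation T where "T \<equiv> tangent_space A"

lemma A: "complex_manifold A"
  using kaehler by (simp add: kaehler_manifold_def)

lemma metric:
  assumes "m \<in> carrier_of A" "u \<in> T m" "v \<in> T m"
  shows metric_linear_at: "linear_at A m (g m u)"
    and metric_sym: "g m u v = g m v u"
    and metric_pos: "u \<noteq> (\<lambda>c. 0) \<Longrightarrow> g m u u > 0"
    and metric_cstruct: "g m (cstruct u) (cstruct v) = g m u v"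
  using kaehler assms unfolding kaehler_manifold_def riemannian_metric_def by blast+

lemma metric_right:
  assumes "m \<in> carrier_of A" "u \<in> T m" "v \<in> T m" "w \<in> T m"
  shows "g m w (\<lambda>c. a *\<^sub>R u c + b *\<^sub>R v c) = a * g m w u + b * g m w v"
  using metric_linear_at[OF assms(1,4,4)] assms(2,3) unfolding linear_at_def by blast

lemma metric_left:
  assumes "m \<in> carrier_of A" "u \<in> T m" "v \<in> T m" "w \<in> T m"
  shows "g m (\<lambda>c. a *\<^sub>R u c + b *\<^sub>R v c) w = a * g m u w + b * g m v w"
  using metric_right[OF assms] metric_sym[OF assms(1)] tangent_space_linear[OF A assms(1-3)] assms
  by simp

lemma tangent_diff:
  assumes "m \<in> carrier_of A" "u \<in> T m" "v \<in> T m"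
  shows "(\<lambda>c. u c - v c) \<in> T m"
  using tangent_space_linear[OF A assms, of 1 "-1"] by simp

lemma metric_diff:
  assumes "m \<in> carrier_of A" "u \<in> T m" "v \<in> T m" "w \<in> T m"
  shows "g m (\<lambda>c. u c - v c) w = g m u w - g m v w"
    and "g m w (\<lambda>c. u c - v c) = g m w u - g m w v"
  using metric_left[OF assms, of 1 "-1"] metric_right[OF assms, of 1 "-1"] by simp_all

lemma metric_bilinear_coord:
  assumes c: "c \<in> A" "m \<in> cdom c"
  shows "bilinear (\<lambda>h k. g m (coord_vec A c m h) (coord_vec A c m k))"
proof -
  have m: "m \<in> carrier_of A" using c by (auto simp: carrier_of_def)
  note t = coord_vec_tangent[OF A c]
  have "linear (\<lambda>k. g m (coord_vec A c m h) (coord_vec A c m k))" for h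
    by (rule linear_at_coord_vec[OF A c metric_linear_at[OF m t t]])
  then show ?thesis
    unfolding bilinear_def using metric_sym[OF m t t] by simp
qed

lemma smooth_metric: "smooth_bilinear_field A g"
  unfolding smooth_bilinear_field_def
proof (intro ballI conjI allI)
  fix c x assume c: "c \<in> A" and "x \<in> cmap c ` cdom c"
  then obtain m where m: "m \<in> cdom c" "x = cmap c m" by blast
  show "bilinear (\<lambda>h k. local_coeff A g c h k x)"
    unfolding m(2) local_coeff_cmap[OF A c m(1)] by (rule metric_bilinear_coord[OF c m(1)])
next
  fix c h k assume "c \<in> A"
  then show "smooth_on (cmap c ` cdom c) (local_coeff A g c h k)"
    using kaehler unfolding kaehler_manifold_def riemannian_metric_def by blast
qed

lemma smooth_kaehler_form: "smooth_bilinear_field A (kaehler_form g)"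
  unfolding smooth_bilinear_field_def
proof (intro ballI conjI allI)
  have coeff: "local_coeff A (kaehler_form g) c h k x = local_coeff A g c (\<i> *s h) k x"
    if "c \<in> A" "x \<in> cmap c ` cdom c" for c h k x
    using that by (auto simp: local_coeff_cmap[OF A] kaehler_form_def cstruct_coord_vec[OF A])
  fix c assume c: "c \<in> A"
  show "bilinear (\<lambda>h k. local_coeff A (kaehler_form g) c h k x)" if x: "x \<in> cmap c ` cdom c" for x
  proof -
    have b: "bilinear (\<lambda>h k. local_coeff A g c h k x)"
      using smooth_metric c x unfolding smooth_bilinear_field_def by blast
    have "linear (\<lambda>h :: complex^'n. \<i> *s h)"
      by (rule linearI) (simp_all add: vec_eq_iff algebra_simps)
    then show ?thesis
      unfolding coeff[OF c x] using b unfolding bilinear_def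
      by (auto intro: linear_compose[unfolded comp_def, where g="\<lambda>h. local_coeff A g c h _ x"])
  qed
  show "smooth_on (cmap c ` cdom c) (local_coeff A (kaehler_form g) c h k)" for h k
  proof -
    have "smooth_on (cmap c ` cdom c) (local_coeff A g c (\<i> *s h) k)"
      using smooth_metric c unfolding smooth_bilinear_field_def by blast
    then show ?thesis
      by (rule smooth_on_cong[OF open_chart_image[OF A c], THEN iffD1, rotated]) (rule coeff[OF c, symmetric])
  qed
qed

lemma cstruct_cstruct: "cstruct (cstruct u) = (\<lambda>c. - u c)"
  by (simp add: cstruct_def fun_eq_iff vec_eq_iff)

text \<open>An isometry whose square is minus the identity is skew-adjoint.\<close>

lemma metric_cstruct_skew:
  assumes m: "m \<in> carrier_of A" and u: "u \<in> T m" and v: "v \<in> T m"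
  shows "g m u (cstruct v) = - g m (cstruct u) v"
proof -
  have "g m u (cstruct v) = g m (cstruct u) (cstruct (cstruct v))"
    by (rule metric_cstruct[OF m u cstruct_tangent[OF A m v], symmetric])
  also have "\<dots> = - g m (cstruct u) v"
    unfolding cstruct_cstruct
    using metric_right[OF m v v cstruct_tangent[OF A m u], of "-1" 0] by simp
  finally show ?thesis .
qed

lemma kaehler_form_antisym:
  assumes "m \<in> carrier_of A" "u \<in> T m" "v \<in> T m"
  shows "kaehler_form g m u v = - kaehler_form g m v u"
  using metric_cstruct_skew[OF assms(1,3,2)] metric_sym[OF assms(1) cstruct_tangent[OF A assms(1,2)] assms(3)]
  by (simp add: kaehler_form_def)

section \<open>Musical isomorphisms\<close>

definition flat :: "'m \<Rightarrow> ('m, 'n) tvec \<Rightarrow> ('m, 'n) tvec \<Rightarrow> real" where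
  "flat m v = (\<lambda>u. if u \<in> T m then g m v u else 0)"

lemma flat_cotangent:
  assumes "m \<in> carrier_of A" "v \<in> T m"
  shows "flat m v \<in> cotangent_space A m"
  using metric_right[OF assms(1)] assms tangent_space_linear[OF A assms(1)]
  by (simp add: cotangent_space_def linear_at_def flat_def)

lemma tangent_eqI:
  assumes m: "m \<in> carrier_of A" and v: "v \<in> T m" and w: "w \<in> T m"
    and eq: "\<And>u. u \<in> T m \<Longrightarrow> g m v u = g m w u"
  shows "v = w"
proof (rule ccontr)
  assume "v \<noteq> w"
  then have "(\<lambda>c. v c - w c) \<noteq> (\<lambda>c. 0)" by (auto simp: fun_eq_iff)
  moreover have d: "(\<lambda>c. v c - w c) \<in> T m" by (rule tangent_diff[OF m v w])
  ultimately have "g m (\<lambda>c. v c - w c) (\<lambda>c. v c - w c) > 0" by (intro metric_pos[OF m d d])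
  then show False using metric_diff(1)[OF m v w d] eq[OF d] by simp
qed

lemma sharp_eqI:
  assumes m: "m \<in> carrier_of A" and v: "v \<in> T m" and eq: "\<And>u. u \<in> T m \<Longrightarrow> g m v u = p u"
  shows "sharp A g m p = v"
  unfolding sharp_def
  using v eq by (intro the_equality) (auto intro: tangent_eqI[OF m])

lemma sharp_flat: "m \<in> carrier_of A \<Longrightarrow> v \<in> T m \<Longrightarrow> sharp A g m (flat m v) = v"
  by (rule sharp_eqI) (simp_all add: flat_def)

lemma sharp:
  assumes m: "m \<in> carrier_of A" and p: "p \<in> cotangent_space A m"
  shows sharp_tangent: "sharp A g m p \<in> T m"
    and metric_sharp: "u \<in> T m \<Longrightarrow> g m (sharp A g m p) u = p u"
proof -
  obtain c where c: "c \<in> A" "m \<in> cdom c" using m by (rule carrier_ofE)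
  have lin: "linear (\<lambda>h. p (coord_vec A c m h))"
    by (rule linear_at_coord_vec[OF A c]) (use p in \<open>simp add: cotangent_space_def\<close>)
  have pos: "g m (coord_vec A c m h) (coord_vec A c m h) > 0" if "h \<noteq> 0" for h
    using metric_pos[OF m coord_vec_tangent[OF A c] coord_vec_tangent[OF A c], of h]
      coord_vec_chart[OF A c, of h] that by (metis)
  obtain v where v: "\<And>k. g m (coord_vec A c m v) (coord_vec A c m k) = p (coord_vec A c m k)"
    using riesz_bilinear[OF metric_bilinear_coord[OF c] pos lin] by blast
  have v': "g m (coord_vec A c m v) u = p u" if "u \<in> T m" for u
    using v[of "u c"] coord_vec_of_tangent[OF c that] by simp
  have eq: "sharp A g m p = coord_vec A c m v"
    by (rule sharp_eqI[OF m coord_vec_tangent[OF A c]]) (rule v')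
  show "sharp A g m p \<in> T m" unfolding eq by (rule coord_vec_tangent[OF A c])
  show "g m (sharp A g m p) u = p u" if "u \<in> T m" unfolding eq by (rule v'[OF that])
qed

lemma flat_sharp:
  assumes "m \<in> carrier_of A" "p \<in> cotangent_space A m"
  shows "flat m (sharp A g m p) = p"
  using metric_sharp[OF assms] assms(2) by (auto simp: flat_def cotangent_space_def fun_eq_iff)

text \<open>Although \<open>sharp\<close> is a definite description at each point, it solves a linear system with continuous
  coefficients in a chart, and so it depends continuously on the covector. The integrals below exist for this reason.\<close>

lemma continuous_covector_norm:
  assumes Z: "smooth_into (cotangent_atlas A) S Z" "open S"
  shows "continuous_on S (\<lambda>x. H0 A g (Z x))"
proof (rule continuous_at_imp_continuous_on, rule ballI)
  fix x assume x: "x \<in> S"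
  note q = smooth_into_base[OF Z]
  obtain c where c: "c \<in> A" "fst (Z x) \<in> cdom c" using smooth_into_carrier[OF q x] .
  define U where "U = {x \<in> S. fst (Z x) \<in> cdom c}"
  define cv where "cv y = coord_vec A c (fst (Z y))" for y
  define w where "w y = sharp A g (fst (Z y)) (snd (Z y))" for y
  have U: "open U" "x \<in> U" using smooth_into_open[OF q Z(2) c(1)] x c by (auto simp: U_def)
  have y: "fst (Z y) \<in> cdom c" "fst (Z y) \<in> carrier_of A" "snd (Z y) \<in> cotangent_space A (fst (Z y))"
    if "y \<in> U" for y
    using that c smooth_into_cotangent_covector[OF Z(1)] by (auto simp: U_def carrier_of_def)
  have w: "w y \<in> T (fst (Z y))" "cv y (w y c) = w y" if "y \<in> U" for y
    using y[OF that] sharp_tangent coord_vec_of_tangent[OF c(1)] by (auto simp: w_def cv_def)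
  have cB: "isCont (\<lambda>y. g (fst (Z y)) (cv y h) (cv y k)) x" for h k
  proof -
    have "smooth_on U (\<lambda>y. g (fst (Z y)) (cv y h) (cv y k))"
      using smooth_on_pairing_chart[OF A smooth_metric q Z(2) c(1), of "\<lambda>_. h" "\<lambda>_. k"]
        smooth_on_const[OF U(1)] by (auto simp: U_def cv_def)
    then show ?thesis using U smooth_on_continuous continuous_on_eq_continuous_at by blast
  qed
  have ca: "isCont (\<lambda>y. snd (Z y) (cv y h)) x" for h
  proof -
    have "smooth_on U (\<lambda>y. snd (Z y) (cv y h))"
      using smooth_into_covector_coeff[OF A Z c(1)] by (auto simp: U_def cv_def)
    then show ?thesis using U smooth_on_continuous continuous_on_eq_continuous_at by blast
  qed
  have lin: "linear (\<lambda>h. snd (Z y) (cv y h))" if "y \<in> U" for y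
    unfolding cv_def by (rule linear_at_coord_vec[OF A c(1)]) (use y[OF that] in \<open>auto simp: cotangent_space_def\<close>)
  have wc: "isCont (\<lambda>y. w y c) x"
  proof (rule riesz_solution_continuous[OF U, where B="\<lambda>y h k. g (fst (Z y)) (cv y h) (cv y k)"
        and a="\<lambda>y h. snd (Z y) (cv y h)"])
    show "bilinear (\<lambda>h k. g (fst (Z y)) (cv y h) (cv y k))" if "y \<in> U" for y
      unfolding cv_def by (rule metric_bilinear_coord[OF c(1) y(1)[OF that]])
    show "g (fst (Z x)) (cv x h) (cv x h) > 0" if "h \<noteq> 0" for h
      unfolding cv_def
      using metric_pos[OF y(2)[OF U(2)] coord_vec_tangent[OF A c] coord_vec_tangent[OF A c], of h]
        coord_vec_chart[OF A c, of h] that by metis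
    show "g (fst (Z y)) (cv y (w y c)) (cv y k) = snd (Z y) (cv y k)" if "y \<in> U" for y k
      unfolding w(2)[OF that] unfolding w_def
      by (rule metric_sharp[OF y(2,3)[OF that]])
        (unfold cv_def, rule coord_vec_tangent[OF A c(1) y(1)[OF that]])
  qed (use lin cB ca in auto)
  have cont: "isCont (\<lambda>y. (\<Sum>E\<in>Basis. (w y c \<bullet> E) * snd (Z y) (cv y E)) / 2) x"
    by (intro continuous_intros wc ca) simp
  have eq: "(\<Sum>E\<in>Basis. (w y c \<bullet> E) * snd (Z y) (cv y E)) / 2 = H0 A g (Z y)" if "y \<in> U" for y
  proof -
    have "(\<Sum>E\<in>Basis. (w y c \<bullet> E) * snd (Z y) (cv y E)) = snd (Z y) (cv y (\<Sum>E\<in>Basis. (w y c \<bullet> E) *\<^sub>R E))"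
      unfolding linear_sum[OF lin[OF that]] using linear_scale[OF lin[OF that]] by simp
    also have "\<dots> = snd (Z y) (w y)" by (simp add: euclidean_representation w(2)[OF that])
    also have "\<dots> = g (fst (Z y)) (w y) (w y)"
      using metric_sharp[OF y(2,3)[OF that] w(1)[OF that]] by (simp add: w_def)
    finally show ?thesis by (simp add: H0_def dual_metric_def w_def split_beta)
  qed
  have ev: "\<forall>\<^sub>F y in nhds x. (\<Sum>E\<in>Basis. (w y c \<bullet> E) * snd (Z y) (cv y E)) / 2 = H0 A g (Z y)"
    using eq U unfolding eventually_nhds by blast
  show "isCont (\<lambda>x. H0 A g (Z x)) x"
    by (rule isCont_cong[OF ev, THEN iffD1, OF cont])
qed

end

section \<open>Integration over the torus\<close>

text \<open>Reduces statements at a point of the plane to the unit square.\<close>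

lemma doubly_periodic_int:
  assumes "doubly_periodic f"
  shows "f (x + of_int m, y + of_int n) = f (x, y)"
proof -
  have 1: "f (x + of_int m, y) = f (x, y)" for x y and m :: int
  proof (induction m rule: int_induct[where k=0])
    case (step1 i)
    then show ?case using assms unfolding doubly_periodic_def by (metis add.assoc of_int_1 of_int_add)
  next
    case (step2 i)
    have "f (x + of_int (i - 1) + 1, y) = f (x + of_int (i - 1), y)"
      using assms unfolding doubly_periodic_def by blast
    then show ?case using step2 by simp
  qed simp
  have 2: "f (x, y + of_int n) = f (x, y)" for x y and n :: int
  proof (induction n rule: int_induct[where k=0])
    case (step1 i)
    then show ?case using assms unfolding doubly_periodic_def by (metis add.assoc of_int_1 of_int_add)
  next
    case (step2 i)
    have "f (x, y + of_int (i - 1) + 1) = f (x, y + of_int (i - 1))"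
      using assms unfolding doubly_periodic_def by blast
    then show ?case using step2 by simp
  qed simp
  show ?thesis using 1 2 by metis
qed

text \<open>A nonnegative continuous function with vanishing integral vanishes on the unit square; periodicity
  extends this to the plane.\<close>

lemma torus_integral_eq_0:
  assumes "doubly_periodic f" "continuous_on UNIV f" "\<And>t. f t \<ge> 0" "torus_integral f = 0"
  shows "f t = 0"
proof -
  obtain x y where t: "t = (x, y)" by fastforce
  have "(1/2, 1/2) \<in> box (0, 0) (1 :: real, 1 :: real)"
    by (auto simp: mem_box Basis_prod_def)
  then have "\<forall>t\<in>cbox (0, 0) (1, 1). f t = 0"
    using integral_cbox_eq_0_iff[OF continuous_on_subset[OF assms(2) subset_UNIV], of "(0, 0)" "(1, 1)"]
      assms(3,4) unfolding torus_integral_def by blast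
  then have "f (frac x, frac y) = 0"
    by (simp add: frac_lt_1 less_imp_le)
  then show ?thesis
    using doubly_periodic_int[OF assms(1), of "frac x" "\<lfloor>x\<rfloor>" "frac y" "\<lfloor>y\<rfloor>"] by (simp add: t frac_def)
qed

lemma frechet_derivative_slice:
  fixes G :: "real \<times> 'b::real_normed_vector \<Rightarrow> 'c::real_normed_vector"
  assumes "G differentiable (at (s, t))"
  shows "((\<lambda>t. G (s, t)) has_derivative (\<lambda>h. frechet_derivative G (at (s, t)) (0, h))) (at t)"
    and "((\<lambda>s. G (s, t)) has_derivative (\<lambda>r. frechet_derivative G (at (s, t)) (r, 0))) (at s)"
proof -
  have d: "(G has_derivative frechet_derivative G (at (s, t))) (at (s, t))"
    using assms by (simp add: frechet_derivative_works)
  have "((\<lambda>t. (s, t)) has_derivative (\<lambda>h. (0, h))) (at t)"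
    "((\<lambda>s. (s, t)) has_derivative (\<lambda>r. (r, 0))) (at s)"
    by (auto intro!: derivative_eq_intros)
  from this[THEN has_derivative_compose, OF d]
  show "((\<lambda>t. G (s, t)) has_derivative (\<lambda>h. frechet_derivative G (at (s, t)) (0, h))) (at t)"
    and "((\<lambda>s. G (s, t)) has_derivative (\<lambda>r. frechet_derivative G (at (s, t)) (r, 0))) (at s)"
    by auto
qed

lemma linear_fst_axis:
  fixes D :: "real \<times> 'b::real_normed_vector \<Rightarrow> real"
  assumes "linear D"
  shows "(\<lambda>r. D (r, 0)) = (*) (D (1, 0))"
proof
  fix r
  have "D (r *\<^sub>R (1, 0)) = r *\<^sub>R D (1, 0)" by (rule linear_scale[OF assms])
  then show "D (r, 0) = D (1, 0) * r" by (simp add: mult.commute)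
qed

lemma linear_snd_axis:
  fixes D :: "'b::real_normed_vector \<times> real \<Rightarrow> real"
  assumes "linear D"
  shows "(\<lambda>r. D (0, r)) = (*) (D (0, 1))"
proof
  fix r
  have "D (r *\<^sub>R (0, 1)) = r *\<^sub>R D (0, 1)" by (rule linear_scale[OF assms])
  then show "D (0, r) = D (0, 1) * r" by (simp add: mult.commute)
qed

lemma smooth_on_Pair_left: "smooth_on UNIV (\<lambda>t::'a::euclidean_space. (s::real, t))"
proof -
  have "smooth_on UNIV (\<lambda>t. (s, 0) + (0, t::'a))"
    by (intro smooth_on_add smooth_on_const smooth_on_bounded_linear[OF _ smooth_on_ident] open_UNIV
        bounded_linear_Pair bounded_linear_zero bounded_linear_ident)
  then show ?thesis by simp
qed

lemma integral_derivative_periodic: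
  fixes f :: "real \<Rightarrow> real"
  assumes "\<And>x. (f has_real_derivative f' x) (at x)" "f 1 = f 0"
  shows "integral (cbox 0 1) f' = 0"
proof -
  have "(f' has_integral f 1 - f 0) {0..1}"
    by (rule fundamental_theorem_of_calculus)
      (auto intro: assms has_field_derivative_at_within
        simp: has_real_derivative_iff_has_vector_derivative[symmetric])
  then show ?thesis using assms(2) by (simp add: integral_unique)
qed

text \<open>Fubini and the fundamental theorem of calculus: the boundary contributions cancel by periodicity.\<close>

lemma torus_integral_derivative:
  assumes P: "smooth_on UNIV P" "doubly_periodic P"
  shows "torus_integral (\<lambda>t. frechet_derivative P (at t) (1, 0)) = 0"
    and "torus_integral (\<lambda>t. frechet_derivative P (at t) (0, 1)) = 0"
proof -
  have c: "continuous_on B (\<lambda>t. frechet_derivative P (at t) h)" for h B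
    using smooth_on_continuous[OF smooth_on_frechet_derivative[OF P(1)]] continuous_on_subset by blast
  have diff: "P differentiable (at t)" for t
    using smooth_on_has_derivative[OF P(1) UNIV_I] unfolding differentiable_def by blast
  note lin = linear_frechet_derivative[OF diff]
  have dx: "((\<lambda>x. P (x, y)) has_real_derivative frechet_derivative P (at (x, y)) (1, 0)) (at x)" for x y
    using frechet_derivative_slice(2)[OF diff, of y x]
    unfolding linear_fst_axis[OF lin[of "(x,y)"]] has_field_derivative_def .
  have dy: "((\<lambda>y. P (x, y)) has_real_derivative frechet_derivative P (at (x, y)) (0, 1)) (at y)" for x y
    using frechet_derivative_slice(1)[OF diff, of x y]
    unfolding linear_snd_axis[OF lin[of "(x,y)"]] has_field_derivative_def .
  have per: "P (1, y) = P (0, y)" "P (x, 1) = P (x, 0)" for x y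
    using P(2) unfolding doubly_periodic_def by (metis add_0)+
  have "integral (cbox 0 1) (\<lambda>x. integral (cbox 0 1) (\<lambda>y. frechet_derivative P (at (x, y)) (1, 0))) =
      integral (cbox 0 1) (\<lambda>y. integral (cbox 0 1) (\<lambda>x. frechet_derivative P (at (x, y)) (1, 0)))"
    by (rule integral_swap_continuous) (use c[of "cbox (0,0) (1,1)" "(1,0)"] in \<open>simp add: split_beta\<close>)
  then show "torus_integral (\<lambda>t. frechet_derivative P (at t) (1, 0)) = 0"
    unfolding torus_integral_def integral_prod_continuous[OF c]
    by (simp add: integral_derivative_periodic[OF dx per(1), unfolded cbox_interval])
  show "torus_integral (\<lambda>t. frechet_derivative P (at t) (0, 1)) = 0"
    unfolding torus_integral_def integral_prod_continuous[OF c]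
    by (simp add: integral_derivative_periodic[OF dy per(2), unfolded cbox_interval])
qed

text \<open>Stokes' theorem on the torus, as infinitesimal homotopy invariance: along a family over \<open>I\<close>
  the three components of a closed 2-form on \<open>I \<times> \<T>\<^sup>2\<close> satisfy the relation \<open>closed\<close>.\<close>

lemma torus_integral_closed_stationary:
  fixes F P R :: "real \<times> real \<times> real \<Rightarrow> real"
  defines "I e \<equiv> {-e<..<e} \<times> UNIV"
  assumes e: "e > 0" and sm: "smooth_on (I e) F" "smooth_on (I e) P" "smooth_on (I e) R"
    and per: "\<And>s. s \<in> {-e<..<e} \<Longrightarrow> doubly_periodic (\<lambda>t. P (s, t))"
      "\<And>s. s \<in> {-e<..<e} \<Longrightarrow> doubly_periodic (\<lambda>t. R (s, t))"
    and closed: "\<And>x. x \<in> I e \<Longrightarrow> frechet_derivative F (at x) (1, 0, 0) =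
      frechet_derivative P (at x) (0, 1, 0) - frechet_derivative R (at x) (0, 0, 1)"
  shows "((\<lambda>s. torus_integral (\<lambda>t. F (s, t))) has_real_derivative 0) (at 0)"
proof -
  have op: "open (I e)" unfolding I_def by (intro open_Times) auto
  have diff: "G differentiable (at (s, t))" if "smooth_on (I e) G" "s \<in> {-e<..<e}"
    for G :: "real \<times> real \<times> real \<Rightarrow> real" and s t
    using smooth_on_has_derivative[OF that(1), of "(s, t)"] that(2) by (auto simp: differentiable_def I_def)
  have slice: "smooth_on UNIV (\<lambda>t. G (s, t))" if "smooth_on (I e) G" "s \<in> {-e<..<e}"
    for G :: "real \<times> real \<times> real \<Rightarrow> real" and s
    by (rule smooth_on_compose[OF open_UNIV op _ smooth_on_Pair_left that(1)]) (use that(2) in \<open>auto simp: I_def\<close>)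
  have zero: "torus_integral (\<lambda>t. frechet_derivative F (at (0, t)) (1, 0, 0)) = 0"
  proof -
    have 0: "(0::real) \<in> {-e<..<e}" using e by simp
    have deriv: "frechet_derivative (\<lambda>t. G (0, t)) (at t) h = frechet_derivative G (at (0, t)) (0, h)"
      if "smooth_on (I e) G" for G :: "real \<times> real \<times> real \<Rightarrow> real" and t h
      by (rule fun_cong[OF frechet_derivative_at[OF frechet_derivative_slice(1)[OF diff[OF that 0]]], symmetric])
    have int: "(\<lambda>t. frechet_derivative G (at (0, t)) (0, h)) integrable_on cbox (0,0) (1,1)"
      if "smooth_on (I e) G" for G :: "real \<times> real \<times> real \<Rightarrow> real" and h
      unfolding deriv[OF that, symmetric]
      by (intro integrable_continuous continuous_on_subset[OF smooth_on_continuous[OF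
              smooth_on_frechet_derivative[OF slice[OF that 0]]]]) simp
    have "torus_integral (\<lambda>t. frechet_derivative F (at (0, t)) (1, 0, 0)) =
        torus_integral (\<lambda>t. frechet_derivative P (at (0, t)) (0, 1, 0) - frechet_derivative R (at (0, t)) (0, 0, 1))"
      using closed e by (simp add: I_def)
    also have "\<dots> = torus_integral (\<lambda>t. frechet_derivative P (at (0, t)) (0, 1, 0))
        - torus_integral (\<lambda>t. frechet_derivative R (at (0, t)) (0, 0, 1))"
      unfolding torus_integral_def by (rule integral_diff[OF int[OF sm(2)] int[OF sm(3)]])
    also have "\<dots> = 0"
      using torus_integral_derivative(1)[OF slice[OF sm(2) 0] per(1)[OF 0]]
        torus_integral_derivative(2)[OF slice[OF sm(3) 0] per(2)[OF 0]]
      by (simp add: deriv[OF sm(2)] deriv[OF sm(3)])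
    finally show ?thesis .
  qed
  have "((\<lambda>s. integral (cbox (0,0) (1,1)) (\<lambda>t. F (s, t))) has_field_derivative
      integral (cbox (0,0) (1,1)) (\<lambda>t. frechet_derivative F (at (0, t)) (1, 0, 0))) (at 0 within {-e<..<e})"
  proof (rule leibniz_rule_field_derivative[where fx="\<lambda>s t. frechet_derivative F (at (s, t)) (1, 0, 0)"])
    fix s :: real and t :: "real \<times> real" assume s: "s \<in> {-e<..<e}"
    have "linear (frechet_derivative F (at (s, t)))"
      by (rule linear_frechet_derivative[OF diff[OF sm(1) s]])
    then have "((\<lambda>s. F (s, t)) has_real_derivative frechet_derivative F (at (s, t)) (1, 0)) (at s)"
      using frechet_derivative_slice(2)[OF diff[OF sm(1) s, of t]]
      by (simp add: has_field_derivative_def linear_fst_axis)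
    then show "((\<lambda>s. F (s, t)) has_field_derivative frechet_derivative F (at (s, t)) (1, 0, 0)) (at s within {-e<..<e})"
      using has_field_derivative_at_within by (simp add: zero_prod_def)
  next
    fix s :: real assume s: "s \<in> {-e<..<e}"
    show "(\<lambda>t. F (s, t)) integrable_on cbox (0,0) (1,1)"
      by (intro integrable_continuous continuous_on_subset[OF smooth_on_continuous[OF slice[OF sm(1) s]]]) simp
  next
    have "continuous_on (I e) (\<lambda>x. frechet_derivative F (at x) (1, 0, 0))"
      by (rule smooth_on_continuous[OF smooth_on_frechet_derivative[OF sm(1)]])
    then show "continuous_on ({-e<..<e} \<times> cbox (0,0) (1,1)) (\<lambda>(s, t). frechet_derivative F (at (s, t)) (1, 0, 0))"
      by (auto simp: split_beta I_def elim!: continuous_on_subset)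
  qed (use e in auto)
  then show ?thesis
    using zero e unfolding torus_integral_def by (simp add: at_within_open[of 0 "{-e<..<e}"])
qed

section \<open>Maps from the torus\<close>

lemma doubly_periodic_map2:
  "doubly_periodic f \<Longrightarrow> doubly_periodic h \<Longrightarrow> doubly_periodic (\<lambda>t. F (f t) (h t))"
  by (simp add: doubly_periodic_def)

lemma doubly_periodic_dir_deriv:
  assumes "doubly_periodic f"
  shows "doubly_periodic (\<lambda>t. dir_deriv A f t h)"
proof -
  have "(\<lambda>t. f (t + (1, 0))) = f" "(\<lambda>t. f (t + (0, 1))) = f"
    using assms by (auto simp: doubly_periodic_def)
  then have "dir_deriv A f (t + (1, 0)) h = dir_deriv A f t h" "dir_deriv A f (t + (0, 1)) h = dir_deriv A f t h" for t
    unfolding dir_deriv_shift[of A f _ t h, symmetric] by simp_all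
  from this[of "(_, _)"] show ?thesis unfolding doubly_periodic_def by simp
qed

text \<open>A variation is periodic only for parameters in an open interval, so the periodicity of its
  derivatives is a local matter.\<close>

lemma dir_deriv_cong_open:
  fixes A :: "('m, 'n::finite) chart set" and f f' :: "'a::euclidean_space \<Rightarrow> 'm"
  assumes "open S" "x \<in> S" "\<And>y. y \<in> S \<Longrightarrow> f y = f' y"
  shows "dir_deriv A f x h = dir_deriv A f' x h"
proof -
  have "frechet_derivative (cmap c \<circ> f) (at x) = frechet_derivative (cmap c \<circ> f') (at x)" for c :: "('m, 'n) chart"
  proof -
    have "(cmap c \<circ> f has_derivative D) (at x) \<longleftrightarrow> (cmap c \<circ> f' has_derivative D) (at x)" for D
      using has_derivative_transform_within_open[OF _ assms(1,2), of "cmap c \<circ> f" D UNIV "cmap c \<circ> f'"]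
        has_derivative_transform_within_open[OF _ assms(1,2), of "cmap c \<circ> f'" D UNIV "cmap c \<circ> f"]
        assms(3) by auto
    then show ?thesis by (simp add: frechet_derivative_def)
  qed
  then show ?thesis unfolding dir_deriv_def using assms(3)[OF assms(2)] by (intro ext) simp
qed

lemma dir_deriv_slice:
  fixes F :: "real \<times> 'a::euclidean_space \<Rightarrow> 'm"
  assumes F: "smooth_into A S F" "(s, t) \<in> S"
  shows "dir_deriv A (\<lambda>t. F (s, t)) t h = dir_deriv A F (s, t) (0, h)"
proof
  fix c
  show "dir_deriv A (\<lambda>t. F (s, t)) t h c = dir_deriv A F (s, t) (0, h) c"
  proof (cases "c \<in> A \<and> F (s, t) \<in> cdom c")
    case True
    have "((cmap c \<circ> F) has_derivative frechet_derivative (cmap c \<circ> F) (at (s, t))) (at (s, t))"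
      using smooth_on_has_derivative[OF smooth_into_smooth[OF F(1)], of c "(s, t)"] True F(2)
      by (simp add: comp_def)
    then have "(cmap c \<circ> F) differentiable (at (s, t))" by (auto simp: differentiable_def)
    from fun_cong[OF frechet_derivative_at[OF frechet_derivative_slice(1)[OF this]], of h]
    show ?thesis using True by (simp add: dir_deriv_def comp_def)
  qed (auto simp: dir_deriv_def)
qed

lemma smooth_into_slice:
  fixes F :: "real \<times> 'a::euclidean_space \<Rightarrow> 'm"
  assumes "smooth_into A (I \<times> UNIV) F" "open I" "s \<in> I"
  shows "smooth_into A UNIV (\<lambda>t. F (s, t))"
  by (rule smooth_into_compose[OF assms(1) _ _ smooth_on_Pair_left])
    (use assms in \<open>auto intro: open_Times\<close>)

lemma cotangent_space_combination:
  assumes "p \<in> cotangent_space A m" "p' \<in> cotangent_space A m"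
  shows "(\<lambda>u. p u + s * (p' u - p u)) \<in> cotangent_space A m"
  using assms by (auto simp: cotangent_space_def linear_at_def algebra_simps)

lemma smooth_variation_smooth:
  assumes "smooth_variation A f e W"
  shows "smooth_into A ({-e<..<e} \<times> UNIV) (\<lambda>x. W (fst x) (snd x))"
  using assms by (simp add: smooth_variation_def case_prod_unfold)

context kaehler
begin

section \<open>The Legendre transform\<close>

text \<open>For \<open>a\<close> and \<open>b\<close> the directions of \<open>x\<close> and \<open>y\<close> this is \<open>\<partial>\<^sub>x f - \<i> \<partial>\<^sub>y f\<close>, twice the Wirtinger derivative of \<open>f\<close>
  in the holomorphic coordinate \<open>x + \<i> y\<close>. The directions are parameters because \<open>f\<close> may depend on a
  further variable.\<close>

definition cr :: "('a::euclidean_space \<Rightarrow> 'm) \<Rightarrow> 'a \<Rightarrow> 'a \<Rightarrow> 'a \<Rightarrow> ('m, 'n) tvec" where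
  "cr f a b x = (\<lambda>c. dir_deriv A f x a c - cstruct (dir_deriv A f x b) c)"

abbreviation dz :: "(real \<times> real \<Rightarrow> 'm) \<Rightarrow> real \<times> real \<Rightarrow> ('m, 'n) tvec" where
  "dz q \<equiv> cr q (1, 0) (0, 1)"

text \<open>The covector that maximises the integrand \<open>p (v) - \<bar>p\<bar>\<^sup>2 / 2\<close> of the action, for \<open>v\<close> the derivative \<open>dz q\<close>.\<close>

definition lift :: "(real \<times> real \<Rightarrow> 'm) \<Rightarrow> real \<times> real \<Rightarrow> ('m, 'n) cotangent" where
  "lift q t = (q t, flat (q t) (dz q t))"

lemma smooth_field_along_cr:
  assumes f: "smooth_into A S f" "open S"
  shows "smooth_field_along A S f (cr f a b)"
  unfolding smooth_field_along_def
proof (intro conjI ballI)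
  fix x assume x: "x \<in> S"
  show "cr f a b x \<in> T (f x)"
    unfolding cr_def
    by (intro tangent_diff cstruct_tangent A dir_deriv_tangent[OF A f x] smooth_into_carrier_of[OF f(1) x])
next
  fix c assume c: "c \<in> A"
  have "smooth_on {x \<in> S. f x \<in> cdom c} (\<lambda>x. dir_deriv A f x h c)" for h
    using smooth_field_along_dir_deriv[OF A f] c unfolding smooth_field_along_def by blast
  moreover have "bounded_linear (\<lambda>h :: complex^'n. \<i> *s h)"
    unfolding linear_conv_bounded_linear[symmetric]
    by (rule linearI) (simp_all add: vec_eq_iff algebra_simps)
  ultimately show "smooth_on {x \<in> S. f x \<in> cdom c} (\<lambda>x. cr f a b x c)"
    unfolding cr_def cstruct_def
    by (intro smooth_on_diff smooth_on_bounded_linear[where L="\<lambda>h. \<i> *s h"] smooth_into_open[OF f c])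
qed

lemma smooth_on_flat_coeff:
  assumes f: "smooth_into A S f" "open S" and v: "smooth_field_along A S f v" and c: "c \<in> A"
  shows "smooth_on {x \<in> S. f x \<in> cdom c} (\<lambda>x. flat (f x) (v x) (coord_vec A c (f x) h))"
proof -
  note o = smooth_into_open[OF f c]
  have "smooth_on {x \<in> S. f x \<in> cdom c} (\<lambda>x. g (f x) (coord_vec A c (f x) (v x c)) (coord_vec A c (f x) h))"
    by (rule smooth_on_pairing_chart[OF A smooth_metric f c _ smooth_on_const[OF o]])
      (use v c in \<open>auto simp: smooth_field_along_def\<close>)
  then show ?thesis
    by (rule smooth_on_cong[OF o, THEN iffD1, rotated])
      (use v c in \<open>auto simp: smooth_field_along_def flat_def coord_vec_of_tangent coord_vec_tangent[OF A]\<close>)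
qed

lemma smooth_into_flat:
  assumes f: "smooth_into A S f" "open S" and v: "smooth_field_along A S f v"
  shows "smooth_into (cotangent_atlas A) S (\<lambda>x. (f x, flat (f x) (v x)))"
proof (rule smooth_into_cotangentI[OF f _ smooth_on_flat_coeff[OF f v]])
  show "flat (f x) (v x) \<in> cotangent_space A (f x)" if "x \<in> S" for x
    by (rule flat_cotangent[OF smooth_into_carrier_of[OF f(1) that]])
      (use v that in \<open>simp add: smooth_field_along_def\<close>)
qed

lemma H0_flat:
  assumes "m \<in> carrier_of A" "v \<in> T m"
  shows "H0 A g (m, flat m v) = g m v v / 2"
  by (simp add: H0_def dual_metric_def sharp_flat[OF assms])

lemma action_eq:
  assumes Z: "smooth_into (cotangent_atlas A) UNIV Z"
  shows "action A H Z = torus_integral (\<lambda>t. snd (Z t) (dz (\<lambda>t. fst (Z t)) t) - H (Z t))"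
proof -
  let ?q = "\<lambda>t. fst (Z t)"
  note q = smooth_into_base[OF Z open_UNIV]
  have "theta1 A (Z t) (deriv_x (cotangent_atlas A) Z t) + theta2 A (Z t) (deriv_y (cotangent_atlas A) Z t)
      = snd (Z t) (dz ?q t)" for t
  proof -
    have m: "?q t \<in> carrier_of A" by (rule smooth_into_carrier_of[OF q]) simp
    have d: "dir_deriv A ?q t h \<in> T (?q t)" for h by (rule dir_deriv_tangent[OF A q open_UNIV UNIV_I])
    have "linear_at A (?q t) (snd (Z t))"
      using smooth_into_cotangent_covector[OF Z UNIV_I] by (simp add: cotangent_space_def)
    then have "snd (Z t) (\<lambda>c. 1 *\<^sub>R u c + (-1) *\<^sub>R v c) = 1 * snd (Z t) u + (-1) * snd (Z t) v"
      if "u \<in> T (?q t)" "v \<in> T (?q t)" for u v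
      using that unfolding linear_at_def by blast
    from this[OF d cstruct_tangent[OF A m d], of "(1,0)" "(0,1)"]
    show ?thesis
      using liouville_dir_deriv[OF A Z open_UNIV UNIV_I]
      by (simp add: theta1_def theta2_def deriv_x_def deriv_y_def cr_def)
  qed
  then show ?thesis by (simp add: action_def)
qed

lemma doubly_periodic_dz: "doubly_periodic q \<Longrightarrow> doubly_periodic (dz q)"
  using doubly_periodic_dir_deriv[of q A "(1,0)"] doubly_periodic_dir_deriv[of q A "(0,1)"]
  by (simp add: doubly_periodic_def cr_def)

text \<open>Consider the vertical variation \<open>p + s (v\<^sup>\<flat> - p)\<close>. Completing the square, the integrand of the action
  is \<open>(\<bar>v\<bar>\<^sup>2 - \<bar>v - p\<^sup>\<sharp>\<bar>\<^sup>2) / 2\<close>, and the variation scales \<open>v - p\<^sup>\<sharp>\<close> by \<open>1 - s\<close>. So the action is the quadratic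
  polynomial \<open>(s - s\<^sup>2 / 2) K\<close> in \<open>s\<close> up to a constant, where \<open>K\<close> is the integral of \<open>\<bar>v - p\<^sup>\<sharp>\<bar>\<^sup>2\<close>. Its derivative at
  \<open>s = 0\<close> is \<open>K\<close>, and \<open>K = 0\<close> forces \<open>p = v\<^sup>\<flat>\<close> everywhere.\<close>

lemma critical_point_is_lift:
  assumes crit: "critical_point (cotangent_atlas A) (action A (H0 A g)) Z"
  shows "Z = lift (\<lambda>t. fst (Z t))"
proof -
  define q where "q t = fst (Z t)" for t
  define p where "p t = snd (Z t)" for t
  define v where "v = dz q"
  define w where "w t = sharp A g (q t) (p t)" for t
  define r where "r t = (\<lambda>c. v t c - w t c)" for t
  define N where "N t = g (q t) (r t) (r t)" for t
  define W where "W s t = (q t, \<lambda>u. p t u + s * (flat (q t) (v t) u - p t u))" for s t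
  have Z: "smooth_into (cotangent_atlas A) UNIV Z" and Zper: "doubly_periodic Z"
    using crit by (auto simp: critical_point_def smooth_torus_map_def)
  have q: "smooth_into A UNIV q" unfolding q_def by (rule smooth_into_base[OF Z open_UNIV])
  have vs: "smooth_field_along A UNIV q v" unfolding v_def by (rule smooth_field_along_cr[OF q open_UNIV])
  have m: "q t \<in> carrier_of A" for t by (rule smooth_into_carrier_of[OF q UNIV_I])
  have p: "p t \<in> cotangent_space A (q t)" for t
    unfolding p_def q_def by (rule smooth_into_cotangent_covector[OF Z UNIV_I])
  have v: "v t \<in> T (q t)" for t using vs unfolding smooth_field_along_def by blast
  have w: "w t \<in> T (q t)" "u \<in> T (q t) \<Longrightarrow> g (q t) (w t) u = p t u" for t u
    unfolding w_def using sharp_tangent[OF m p] metric_sharp[OF m p] by auto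
  have r: "r t \<in> T (q t)" for t unfolding r_def by (rule tangent_diff[OF m v w(1)])
  have qper: "doubly_periodic q" using Zper by (simp add: doubly_periodic_def q_def)
  have vper: "doubly_periodic v" unfolding v_def by (rule doubly_periodic_dz[OF qper])
  have Nper: "doubly_periodic N"
    using Zper vper by (simp add: doubly_periodic_def N_def r_def w_def q_def p_def)
  have HZ: "H0 A g (Z t) = g (q t) (w t) (w t) / 2" for t
    by (simp add: H0_def dual_metric_def split_beta w_def p_def q_def)
  (* This formula contains the norm of p only through the Hamiltonian, whose continuity is known. *)
  have Nval: "N t = g (q t) (v t) (v t) - 2 * p t (v t) + 2 * H0 A g (Z t)" for t
  proof -
    note m = m[of t] and v = v[of t] and w = w(1)[of t] w(2)[of _ t] and r = r[of t]
    show ?thesis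
      using metric_diff(1)[OF m v w(1) r] metric_diff(2)[OF m v w(1) v] metric_diff(2)[OF m v w(1) w(1)]
        metric_sym[OF m v w(1)] w(2)[OF v]
      by (simp add: N_def HZ r_def)
  qed
  have cpv: "continuous_on UNIV (\<lambda>t. p t (v t))"
    using smooth_on_continuous[OF smooth_on_covector_field[OF A Z open_UNIV vs[unfolded q_def[abs_def]]]]
    by (simp add: p_def)
  have cH: "continuous_on UNIV (\<lambda>t. H0 A g (Z t))"
    by (rule continuous_covector_norm[OF Z open_UNIV])
  have cN: "continuous_on UNIV N"
    unfolding Nval
    by (intro continuous_intros cpv cH smooth_on_continuous[OF smooth_on_pairing[OF A smooth_metric q open_UNIV vs vs]])
  have var: "smooth_variation (cotangent_atlas A) Z 1 W"
    unfolding smooth_variation_def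
  proof (intro conjI ballI)
    show "W 0 = Z" by (simp add: fun_eq_iff W_def p_def q_def prod_eq_iff)
    show "doubly_periodic (W s)" for s
      using Zper vper by (simp add: doubly_periodic_def W_def p_def q_def)
    let ?S = "{-1<..<1::real} \<times> (UNIV :: (real \<times> real) set)"
    have S: "open ?S" by (intro open_Times) auto
    have q': "smooth_into A ?S (\<lambda>x. q (snd x))"
      by (rule smooth_into_compose[OF q open_UNIV S smooth_on_bounded_linear[OF S smooth_on_ident[OF S] bounded_linear_snd]]) simp
    have "smooth_into (cotangent_atlas A) ?S (\<lambda>x. (q (snd x),
        \<lambda>u. p (snd x) u + fst x * (flat (q (snd x)) (v (snd x)) u - p (snd x) u)))"
    proof (rule smooth_into_cotangentI[OF q' S])
      show "(\<lambda>u. p (snd x) u + fst x * (flat (q (snd x)) (v (snd x)) u - p (snd x) u))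
          \<in> cotangent_space A (q (snd x))" for x
        by (rule cotangent_space_combination[OF p flat_cotangent[OF m v]])
      fix c h assume c: "c \<in> A"
      let ?U = "{x \<in> ?S. q (snd x) \<in> cdom c}"
      let ?V = "{t \<in> UNIV. q t \<in> cdom c}"
      note o = smooth_into_open[OF q' S c]
      have snd: "smooth_on ?U (\<lambda>x. G (snd x))" if "smooth_on ?V G" for G :: "real \<times> real \<Rightarrow> real"
        by (rule smooth_on_compose[OF o smooth_into_open[OF q open_UNIV c] _
              smooth_on_bounded_linear[OF o smooth_on_ident[OF o] bounded_linear_snd] that]) auto
      have 1: "smooth_on ?U (\<lambda>x. p (snd x) (coord_vec A c (q (snd x)) h))"
        using snd[of "\<lambda>t. p t (coord_vec A c (q t) h)"]
          smooth_into_covector_coeff[OF A Z open_UNIV c] by (simp add: p_def q_def)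
      have 2: "smooth_on ?U (\<lambda>x. flat (q (snd x)) (v (snd x)) (coord_vec A c (q (snd x)) h))"
        by (rule snd[OF smooth_on_flat_coeff[OF q open_UNIV vs c]])
      show "smooth_on ?U (\<lambda>x. p (snd x) (coord_vec A c (q (snd x)) h) + fst x *
          (flat (q (snd x)) (v (snd x)) (coord_vec A c (q (snd x)) h) - p (snd x) (coord_vec A c (q (snd x)) h)))"
        by (intro smooth_on_add smooth_on_mult smooth_on_diff o 1 2
            smooth_on_bounded_linear[OF o smooth_on_ident[OF o] bounded_linear_fst])
    qed
    then show "smooth_into (cotangent_atlas A) ?S (\<lambda>(s, t). W s t)"
      by (simp add: W_def case_prod_unfold)
  qed simp
  define K where "K = torus_integral N"
  have act: "action A (H0 A g) (W s) = action A (H0 A g) Z + (s - s\<^sup>2 / 2) * K" if s: "s \<in> {-1<..<1}" for s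
  proof -
    have Ws: "smooth_into (cotangent_atlas A) UNIV (W s)"
      using smooth_into_slice[OF smooth_variation_smooth[OF var] _ s] by simp
    have "snd (W s t) (v t) - H0 A g (W s t) = (p t (v t) - H0 A g (Z t)) + (s - s\<^sup>2 / 2) * N t" for t
    proof -
      note m = m[of t] and v = v[of t] and w = w(1)[of t] w(2)[of _ t] and r = r[of t] and p = p[of t]
      have ws: "(\<lambda>c. 1 *\<^sub>R w t c + s *\<^sub>R r t c) \<in> T (q t)" (is "?w \<in> _")
        by (rule tangent_space_linear[OF A m w(1) r])
      (* Raising the index turns the path of covectors into the straight path from w to v. *)
      have "sharp A g (q t) (snd (W s t)) = ?w"
      proof (rule sharp_eqI[OF m ws])
        fix u assume u: "u \<in> T (q t)"
        show "g (q t) ?w u = snd (W s t) u"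
          using metric_left[OF m w(1) r u, of 1 s] metric_diff(1)[OF m v w(1) u] w(2)[OF u] u
          by (simp add: W_def flat_def r_def)
      qed
      then have "H0 A g (W s t) = g (q t) ?w ?w / 2"
        by (simp add: H0_def dual_metric_def split_beta W_def)
      also have "g (q t) ?w ?w = g (q t) (w t) (w t) + 2 * s * g (q t) (w t) (r t) + s\<^sup>2 * N t"
        using metric_left[OF m w(1) r ws, of 1 s] metric_right[OF m w(1) r w(1), of 1 s]
          metric_right[OF m w(1) r r, of 1 s] metric_sym[OF m r w(1)]
        by (simp add: N_def power2_eq_square algebra_simps)
      finally have H: "H0 A g (W s t) = H0 A g (Z t) + s * g (q t) (w t) (r t) + s\<^sup>2 / 2 * N t"
        by (simp add: HZ field_simps)
      have "g (q t) (w t) (r t) + N t = g (q t) (v t) (r t)"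
        using metric_diff(1)[OF m v w(1) r] by (simp add: N_def r_def)
      moreover have "g (q t) (v t) (r t) = flat (q t) (v t) (v t) - p t (v t)"
        using metric_diff(2)[OF m v w(1) v] metric_sym[OF m v w(1)] w(2)[OF v] v
        by (simp add: flat_def r_def)
      ultimately have "flat (q t) (v t) (v t) - p t (v t) = g (q t) (w t) (r t) + N t" by simp
      then have "snd (W s t) (v t) = p t (v t) + s * (g (q t) (w t) (r t) + N t)"
        by (simp add: W_def)
      then show ?thesis unfolding H by (simp add: algebra_simps)
    qed
    moreover have "action A (H0 A g) (W s) = torus_integral (\<lambda>t. snd (W s t) (v t) - H0 A g (W s t))"
      unfolding action_eq[OF Ws] by (simp add: W_def v_def)
    ultimately have "action A (H0 A g) (W s) =
        torus_integral (\<lambda>t. (p t (v t) - H0 A g (Z t)) + (s - s\<^sup>2 / 2) * N t)"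
      by simp
    also have "\<dots> = torus_integral (\<lambda>t. p t (v t) - H0 A g (Z t)) + torus_integral (\<lambda>t. (s - s\<^sup>2 / 2) * N t)"
      unfolding torus_integral_def
      by (intro integral_add integrable_continuous continuous_intros continuous_on_subset[OF cpv]
          continuous_on_subset[OF cH] continuous_on_subset[OF cN]) auto
    also have "\<dots> = action A (H0 A g) Z + (s - s\<^sup>2 / 2) * K"
      unfolding action_eq[OF Z] K_def torus_integral_def by (simp add: p_def v_def q_def[abs_def])
    finally show ?thesis .
  qed
  have "((\<lambda>s. action A (H0 A g) (W s)) has_real_derivative 0) (at 0)"
    using crit var unfolding critical_point_def by blast
  then have "((\<lambda>s. action A (H0 A g) Z + (s - s\<^sup>2 / 2) * K) has_real_derivative 0) (at 0)"
    by (rule DERIV_cong_ev[THEN iffD1, OF refl _ refl, rotated])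
      (use act eventually_nhds_in_open[of "{-1<..<1::real}" 0] in \<open>auto elim!: eventually_mono\<close>)
  moreover have "((\<lambda>s. action A (H0 A g) Z + (s - s\<^sup>2 / 2) * K) has_real_derivative K) (at 0)"
    by (auto intro!: derivative_eq_intros)
  ultimately have "K = 0" by (rule DERIV_unique[symmetric])
  have nonneg: "N t \<ge> 0" for t
  proof (cases "r t = (\<lambda>c. 0)")
    case True
    have "g (q t) (\<lambda>c. 0) (\<lambda>c. 0) = 0"
      using metric_left[OF m[of t] r[of t] r[of t] r[of t], of 0 0] True by simp
    then show ?thesis by (simp add: N_def True)
  next
    case False
    then show ?thesis using metric_pos[OF m r r False] by (simp add: N_def)
  qed
  have "r t = (\<lambda>c. 0)" for t
    using torus_integral_eq_0[OF Nper cN nonneg, of t] \<open>K = 0\<close> metric_pos[OF m r r, of t]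
    unfolding K_def N_def by fastforce
  then have "w t = v t" for t by (simp add: r_def fun_eq_iff)
  then have "p t = flat (q t) (v t)" for t
    using flat_sharp[OF m p, of t] by (simp add: w_def)
  then show ?thesis
    by (simp add: fun_eq_iff lift_def prod_eq_iff p_def v_def q_def[abs_def])
qed

section \<open>Action, energy and area\<close>

definition kaehler_area :: "(real \<times> real \<Rightarrow> 'm) \<Rightarrow> real" where
  "kaehler_area q = torus_integral (\<lambda>t. kaehler_form g (q t) (deriv_x A q t) (deriv_y A q t))"

text \<open>On a lift the integrand of the action is \<open>\<bar>v\<bar>\<^sup>2 / 2\<close> with \<open>v = \<partial>\<^sub>x q - \<i> \<partial>\<^sub>y q\<close>. Since \<open>\<i>\<close> is an isometry and
  skew-adjoint, the squares give the energy density and the mixed term gives the Kaehler form.\<close>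

lemma action_lift:
  assumes q: "smooth_into A UNIV q"
  shows "action A (H0 A g) (lift q) = dirichlet_energy A g q + kaehler_area q"
proof -
  have lift: "smooth_into (cotangent_atlas A) UNIV (lift q)"
    using smooth_into_flat[OF q open_UNIV smooth_field_along_cr[OF q open_UNIV]]
    by (simp add: lift_def[abs_def])
  define x where "x t = deriv_x A q t" for t
  define y where "y t = deriv_y A q t" for t
  have fx: "smooth_field_along A UNIV q x" and fy: "smooth_field_along A UNIV q y"
    using smooth_field_along_dir_deriv[OF A q open_UNIV] by (simp_all add: x_def[abs_def] y_def[abs_def] deriv_x_def deriv_y_def)
  have integrand: "snd (lift q t) (dz q t) - H0 A g (lift q t) =
      (g (q t) (x t) (x t) + g (q t) (y t) (y t)) / 2 + kaehler_form g (q t) (x t) (y t)" for t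
  proof -
    have m: "q t \<in> carrier_of A" by (rule smooth_into_carrier_of[OF q UNIV_I])
    have X: "x t \<in> T (q t)" and Y: "y t \<in> T (q t)" using fx fy unfolding smooth_field_along_def by blast+
    have iY: "cstruct (y t) \<in> T (q t)" by (rule cstruct_tangent[OF A m Y])
    have z: "dz q t = (\<lambda>c. x t c - cstruct (y t) c)"
      by (simp add: cr_def x_def y_def deriv_x_def deriv_y_def)
    have zT: "dz q t \<in> T (q t)" unfolding z by (rule tangent_diff[OF m X iY])
    have "g (q t) (dz q t) (dz q t) = g (q t) (x t) (x t) + g (q t) (y t) (y t)
        - 2 * g (q t) (x t) (cstruct (y t))"
      using metric_diff(1)[OF m X iY zT] metric_diff(2)[OF m X iY X] metric_diff(2)[OF m X iY iY]
        metric_cstruct[OF m Y Y] metric_sym[OF m X iY]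
      unfolding z by simp
    also have "g (q t) (x t) (cstruct (y t)) = - kaehler_form g (q t) (x t) (y t)"
      unfolding kaehler_form_def by (rule metric_cstruct_skew[OF m X Y])
    finally have "g (q t) (dz q t) (dz q t) / 2 =
        (g (q t) (x t) (x t) + g (q t) (y t) (y t)) / 2 + kaehler_form g (q t) (x t) (y t)" by simp
    moreover have "snd (lift q t) (dz q t) = g (q t) (dz q t) (dz q t)"
      using zT by (simp add: lift_def flat_def)
    moreover have "H0 A g (lift q t) = g (q t) (dz q t) (dz q t) / 2"
      unfolding lift_def by (rule H0_flat[OF m zT])
    ultimately show ?thesis by linarith
  qed
  note sm = smooth_on_pairing[OF A _ q open_UNIV]
  have "action A (H0 A g) (lift q) = torus_integral (\<lambda>t.
      (g (q t) (x t) (x t) + g (q t) (y t) (y t)) / 2 + kaehler_form g (q t) (x t) (y t))"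
    unfolding action_eq[OF lift] integrand[symmetric] by (simp add: lift_def)
  also have "\<dots> = dirichlet_energy A g q + kaehler_area q"
    unfolding dirichlet_energy_def kaehler_area_def torus_integral_def x_def[symmetric] y_def[symmetric]
    by (intro integral_add integrable_continuous continuous_intros
        continuous_on_subset[OF smooth_on_continuous[OF sm[OF smooth_metric fx fx]]]
        continuous_on_subset[OF smooth_on_continuous[OF sm[OF smooth_metric fy fy]]]
        continuous_on_subset[OF smooth_on_continuous[OF sm[OF smooth_kaehler_form fx fy]]]) auto
  finally show ?thesis .
qed

text \<open>The pullback of the closed Kaehler form to the product of the parameter interval and the torus is closed,
  so Stokes' theorem on the torus applies.\<close>

lemma kaehler_area_stationary:
  assumes W: "smooth_variation A q e W"
  shows "((\<lambda>s. kaehler_area (W s)) has_real_derivative 0) (at 0)"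
proof -
  let ?I = "{-e<..<e}"
  define F where "F x = W (fst x) (snd x)" for x
  define P where "P h k x = kaehler_form g (F x) (dir_deriv A F x h) (dir_deriv A F x k)" for h k x
  have e: "e > 0" using W by (simp add: smooth_variation_def)
  have S: "open (?I \<times> (UNIV :: (real \<times> real) set))" by (intro open_Times) auto
  have F: "smooth_into A (?I \<times> UNIV) F" unfolding F_def by (rule smooth_variation_smooth[OF W])
  have smP: "smooth_on (?I \<times> UNIV) (P h k)" for h k
    unfolding P_def by (intro smooth_on_pairing[OF A smooth_kaehler_form F S] smooth_field_along_dir_deriv[OF A F S])
  have per: "doubly_periodic (\<lambda>t. P h k (s, t))" if s: "s \<in> ?I" for h k s
  proof -
    have Wper: "F (s, x + 1, y) = F (s, x, y)" "F (s, x, y + 1) = F (s, x, y)" if "s \<in> ?I" for s x y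
      using W that by (auto simp: smooth_variation_def doubly_periodic_def F_def)
    have per: "dir_deriv A F ((s, t) + a) h = dir_deriv A F (s, t) h" if a: "a \<in> {(0, 1, 0), (0, 0, 1)}" for a t h
    proof -
      have "dir_deriv A (\<lambda>x. F (x + a)) (s, t) h = dir_deriv A F (s, t) h"
      proof (rule dir_deriv_cong_open[OF S])
        show "(s, t) \<in> ?I \<times> UNIV" using s by simp
        fix y :: "real \<times> real \<times> real" assume "y \<in> ?I \<times> UNIV"
        then show "F (y + a) = F y" using a Wper by (cases y) auto
      qed
      then show ?thesis by (simp only: dir_deriv_shift)
    qed
    have shift: "dir_deriv A F (s, x + 1, y) h = dir_deriv A F (s, x, y) h"
      "dir_deriv A F (s, x, y + 1) h = dir_deriv A F (s, x, y) h" for x y h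
      using per[of "(0, 1, 0)" "(x, y)" h] per[of "(0, 0, 1)" "(x, y)" h] by simp_all
    show ?thesis by (simp add: doubly_periodic_def P_def shift Wper[OF s])
  qed
  have area: "kaehler_area (W s) = torus_integral (\<lambda>t. P (0, 1, 0) (0, 0, 1) (s, t))" if s: "s \<in> ?I" for s
  proof -
    have "dir_deriv A (W s) t h = dir_deriv A F (s, t) (0, h)" for t h
      using dir_deriv_slice[OF F, of s t h] s by (simp add: F_def)
    then show ?thesis
      by (simp add: kaehler_area_def P_def deriv_x_def deriv_y_def F_def)
  qed
  have "((\<lambda>s. torus_integral (\<lambda>t. P (0, 1, 0) (0, 0, 1) (s, t))) has_real_derivative 0) (at 0)"
  proof (rule torus_integral_closed_stationary[OF e smP smP smP per per])
    fix x assume x: "x \<in> ?I \<times> (UNIV :: (real \<times> real) set)"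
    have "closed_two_form A (kaehler_form g)" using kaehler by (simp add: kaehler_manifold_def)
    from pullback_closed[OF A smooth_kaehler_form this kaehler_form_antisym F S x P_def,
        of "(0, 1, 0)" "(0, 0, 1)" "(1, 0, 0)"]
    show "frechet_derivative (P (0, 1, 0) (0, 0, 1)) (at x) (1, 0, 0) =
        frechet_derivative (P (1, 0, 0) (0, 0, 1)) (at x) (0, 1, 0)
        - frechet_derivative (P (1, 0, 0) (0, 1, 0)) (at x) (0, 0, 1)" by linarith
  qed
  then show ?thesis
    by (rule DERIV_cong_ev[THEN iffD1, OF refl _ refl, rotated])
      (use area e eventually_nhds_in_open[of ?I 0] in \<open>auto elim!: eventually_mono\<close>)
qed

text \<open>The lifts are written in terms of derivatives of the whole family, which makes them jointly smooth in
  the parameter and the point; on the interval they agree with the lifts of the individual maps.\<close>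

lemma lift_variation:
  assumes W: "smooth_variation A q e W"
  shows "\<exists>V. smooth_variation (cotangent_atlas A) (lift q) e V \<and> (\<forall>s\<in>{-e<..<e}. V s = lift (W s))"
proof -
  let ?I = "{-e<..<e}"
  define F where "F x = W (fst x) (snd x)" for x
  define V where "V s t = (F (s, t), flat (F (s, t)) (cr F (0, 1, 0) (0, 0, 1) (s, t)))" for s t
  have S: "open (?I \<times> (UNIV :: (real \<times> real) set))" by (intro open_Times) auto
  have F: "smooth_into A (?I \<times> UNIV) F" unfolding F_def by (rule smooth_variation_smooth[OF W])
  have V: "V s = lift (W s)" if "s \<in> ?I" for s
  proof
    fix t
    have "dir_deriv A (W s) t h = dir_deriv A F (s, t) (0, h)" for h
      using dir_deriv_slice[OF F, of s t h] that by (simp add: F_def)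
    then show "V s t = lift (W s) t" by (simp add: V_def lift_def cr_def F_def)
  qed
  have "smooth_variation (cotangent_atlas A) (lift q) e V"
    unfolding smooth_variation_def
  proof (intro conjI ballI)
    show e: "e > 0" using W by (simp add: smooth_variation_def)
    show "V 0 = lift q" using V[of 0] W by (simp add: smooth_variation_def)
    show "doubly_periodic (V s)" if s: "s \<in> ?I" for s
    proof -
      have p: "doubly_periodic (W s)" using W s by (simp add: smooth_variation_def)
      have "V s = (\<lambda>t. (W s t, flat (W s t) (dz (W s) t)))" unfolding V[OF s] by (simp add: fun_eq_iff lift_def)
      then show ?thesis
        using doubly_periodic_map2[OF p doubly_periodic_dz[OF p], of "\<lambda>m v. (m, flat m v)"] by simp
    qed
    have "smooth_into (cotangent_atlas A) (?I \<times> UNIV) (\<lambda>x. (F x, flat (F x) (cr F (0, 1, 0) (0, 0, 1) x)))"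
      by (rule smooth_into_flat[OF F S smooth_field_along_cr[OF F S]])
    then show "smooth_into (cotangent_atlas A) (?I \<times> UNIV) (\<lambda>(s, t). V s t)"
      by (simp add: V_def case_prod_unfold)
  qed
  then show ?thesis using V by blast
qed

text \<open>Along a lifted variation the action and the energy differ by the area, which is stationary.\<close>

lemma harmonic_if_lift_critical:
  assumes crit: "critical_point (cotangent_atlas A) (action A (H0 A g)) (lift q)"
    and q: "smooth_torus_map A q"
  shows "harmonic_map A g q"
  unfolding harmonic_map_def critical_point_def
proof (intro conjI allI impI q)
  fix e W assume W: "smooth_variation A q e W"
  have e: "e > 0" using W by (simp add: smooth_variation_def)
  obtain V where V: "smooth_variation (cotangent_atlas A) (lift q) e V"
    "\<And>s. s \<in> {-e<..<e} \<Longrightarrow> V s = lift (W s)" using lift_variation[OF W] by blast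
  have "((\<lambda>s. action A (H0 A g) (V s)) has_real_derivative 0) (at 0)"
    using crit V(1) unfolding critical_point_def by blast
  from DERIV_diff[OF this kaehler_area_stationary[OF W]]
  have "((\<lambda>s. action A (H0 A g) (V s) - kaehler_area (W s)) has_real_derivative 0) (at 0)" by simp
  moreover have "action A (H0 A g) (V s) - kaehler_area (W s) = dirichlet_energy A g (W s)"
    if s: "s \<in> {-e<..<e}" for s
  proof -
    have "smooth_into A UNIV (W s)"
      using smooth_into_slice[OF smooth_variation_smooth[OF W] _ s] by simp
    then show ?thesis by (simp add: V(2)[OF s] action_lift)
  qed
  ultimately show "((\<lambda>s. dirichlet_energy A g (W s)) has_real_derivative 0) (at 0)"
    by (elim DERIV_cong_ev[THEN iffD1, OF refl _ refl, rotated])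
      (use e eventually_nhds_in_open[of "{-e<..<e}" 0] in \<open>auto elim!: eventually_mono\<close>)
qed

end

theorem proposition2p4:
  fixes A :: "('m, 'n::finite) chart set"
    and g :: "('m, 'n) bilinear_field"
    and Z :: "real \<times> real \<Rightarrow> ('m, 'n) cotangent"
  assumes "kaehler_manifold A g"
    and "critical_point (cotangent_atlas A) (action A (H0 A g)) Z"
  shows "harmonic_map A g (fst \<circ> Z)"
proof -
  interpret kaehler A g by (rule kaehler.intro) (rule assms(1))
  have Z: "Z = lift (fst \<circ> Z)" using critical_point_is_lift[OF assms(2)] by (simp add: comp_def)
  have "smooth_torus_map (cotangent_atlas A) Z" using assms(2) by (simp add: critical_point_def)
  then have "smooth_torus_map A (fst \<circ> Z)"
    using smooth_into_base[of A UNIV Z] by (simp add: smooth_torus_map_def doubly_periodic_def comp_def)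
  moreover have "critical_point (cotangent_atlas A) (action A (H0 A g)) (lift (fst \<circ> Z))"
    using assms(2) Z by simp
  ultimately show ?thesis by (intro harmonic_if_lift_critical)
qed

end
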